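(* Let $G$ be a connected unicyclic graph of order $n$ which is not a cycle, whose unique cycle has length $\ell\geq 6$. Then $trc(G)=2n-7$ if $G\in\{B_6\}\cup\mathcal{J}_1$; otherwise $trc(G)\leq 2n-9$.
   Context: All graphs are finite, simple and undirected. A total-coloring assigns colors to all vertices and edges; a path is total-rainbow if its edges and internal vertices receive pairwise distinct colors; $trc(G)$ is the minimum number of colors in a total-coloring of the connected graph $G$ such that every two distinct vertices are joined by a total-rainbow path. For a connected unicyclic graph $G$ with cycle $C_\ell=u_1u_2\cdots u_\ell u_1$, let $T_i$ ($1\le i\le \ell$) be the component containing $u_i$ of the graph obtained from $G$ by deleting the edges of $C_\ell$ (a tree rooted at $u_i$); $\mathcal{T}_G=\{T_1,\dots,T_\ell\}$, and $T_i$ is nontrivial if it contains at least one edge. $B_6$ denotes the graph of order $n$ consisting of a $6$-cycle $u_1\cdots u_6u_1$ together with a nontrivial path $T_1$ having $u_1$ as an end vertex and meeting the cycle only in $u_1$ (so only $T_1$ is nontrivial). $\mathcal{J}_1$ is the set of unicyclic graphs $G$ of order $n$ with cycle length $6$ such that $\mathcal{T}_G$ contains exactly two nontrivial elements and $diam(G)=n-3$. *)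

theory Defs
  imports "Graph_Theory.Graph_Theory"
begin

text \<open>
  A finite simple undirected graph is a \<^locale>\<open>pair_graph\<close>: finite, loop-free and with
  a symmetric arc relation. An undirected edge is the two-element set of ends of an arc, so
  that both orientations of an edge count as one edge and carry one color.
\<close>

definition edge_of :: "'a \<times> 'a \<Rightarrow> 'a set" where
  "edge_of e = {fst e, snd e}"

definition uedges :: "'a pair_pre_digraph \<Rightarrow> 'a set set" where
  "uedges G = edge_of ` parcs G"

definition path_edges :: "'a list \<Rightarrow> 'a set list" where
  "path_edges p = map edge_of (vwalk_arcs p)"


text \<open>A total-coloring colors the disjoint union of the vertex set and the edge set.\<close>

type_synonym 'a total_coloring = "'a + 'a set \<Rightarrow> nat"

definition num_colors :: "'a pair_pre_digraph \<Rightarrow> 'a total_coloring \<Rightarrow> nat" where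
  "num_colors G c = card (c ` (pverts G <+> uedges G))"

text \<open>The internal vertices of a path \<open>p\<close> are listed by \<open>butlast (tl p)\<close>.\<close>

definition total_rainbow :: "'a total_coloring \<Rightarrow> 'a list \<Rightarrow> bool" where
  "total_rainbow c p \<longleftrightarrow>
     distinct (map (\<lambda>v. c (Inl v)) (butlast (tl p)) @ map (\<lambda>e. c (Inr e)) (path_edges p))"

definition total_rainbow_connected :: "'a pair_pre_digraph \<Rightarrow> 'a total_coloring \<Rightarrow> bool" where
  "total_rainbow_connected G c \<longleftrightarrow>
     (\<forall>u\<in>pverts G. \<forall>v\<in>pverts G. u \<noteq> v \<longrightarrow>
        (\<exists>p. vpath p G \<and> hd p = u \<and> last p = v \<and> total_rainbow c p))"

definition trc :: "'a pair_pre_digraph \<Rightarrow> nat" where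
  "trc G = (LEAST k. \<exists>c. total_rainbow_connected G c \<and> num_colors G c = k)"


definition gdist :: "'a pair_pre_digraph \<Rightarrow> 'a \<Rightarrow> 'a \<Rightarrow> nat" where
  "gdist G u v = (LEAST k. \<exists>p. vpath p G \<and> hd p = u \<and> last p = v \<and> vwalk_length p = k)"

definition diam :: "'a pair_pre_digraph \<Rightarrow> nat" where
  "diam G = Max {gdist G u v | u v. u \<in> pverts G \<and> v \<in> pverts G}"


text \<open>
  A cycle \<open>u\<^sub>1 u\<^sub>2 \<dots> u\<^sub>l u\<^sub>1\<close> is given by the list \<open>[u\<^sub>1, \<dots>, u\<^sub>l]\<close>; as a subgraph it is determined
  by its edge set, which is the same for all rotations and reflections of the list. The
  library's \<open>cycle\<close> is not used because in a symmetric digraph it admits the closed walk of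
  length two along a single edge.
\<close>

definition ucycle :: "'a pair_pre_digraph \<Rightarrow> 'a list \<Rightarrow> bool" where
  "ucycle G us \<longleftrightarrow> 3 \<le> length us \<and> vpath us G \<and> (last us, hd us) \<in> parcs G"

definition cycle_edges :: "'a list \<Rightarrow> 'a set set" where
  "cycle_edges us = insert {last us, hd us} (set (path_edges us))"

definition connected_unicyclic :: "'a pair_pre_digraph \<Rightarrow> bool" where
  "connected_unicyclic G \<longleftrightarrow>
     pair_graph G \<and> Digraph_Component.connected (with_proj G) \<and>
     (\<exists>!C. \<exists>us. ucycle G us \<and> C = cycle_edges us)"

definition is_cycle_graph :: "'a pair_pre_digraph \<Rightarrow> bool" where
  "is_cycle_graph G \<longleftrightarrow>
     (\<exists>us. ucycle G us \<and> pverts G = set us \<and> uedges G = cycle_edges us)"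

definition del_cycle_edges :: "'a pair_pre_digraph \<Rightarrow> 'a list \<Rightarrow> 'a pair_pre_digraph" where
  "del_cycle_edges G us = G\<lparr>parcs := {e \<in> parcs G. edge_of e \<notin> cycle_edges us}\<rparr>"

text \<open>The component containing \<open>u\<close> of the graph without the edges of the cycle \<open>us\<close>.\<close>

definition hanging_tree ::
    "'a pair_pre_digraph \<Rightarrow> 'a list \<Rightarrow> 'a \<Rightarrow> ('a, 'a \<times> 'a) pre_digraph" where
  "hanging_tree G us u =
     (let H = with_proj (del_cycle_edges G us) in H \<restriction> {v. u \<rightarrow>\<^sup>*\<^bsub>H\<^esub> v})"

definition hanging_trees ::
    "'a pair_pre_digraph \<Rightarrow> 'a list \<Rightarrow> ('a, 'a \<times> 'a) pre_digraph set" where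
  "hanging_trees G us = hanging_tree G us ` set us"

definition nontrivial :: "('a, 'b) pre_digraph \<Rightarrow> bool" where
  "nontrivial T \<longleftrightarrow> arcs T \<noteq> {}"


text \<open>The isomorphism class of \<open>B\<^sub>6\<close>, on vertices of type \<open>'a\<close>; \<open>p\<close> is the path \<open>T\<^sub>1\<close>.\<close>

definition B6 :: "nat \<Rightarrow> 'a pair_pre_digraph set" where
  "B6 n = {G. pair_graph G \<and> card (pverts G) = n \<and>
     (\<exists>us p. length us = 6 \<and> distinct us \<and>
        2 \<le> length p \<and> distinct p \<and> hd p = hd us \<and> set us \<inter> set p = {hd us} \<and>
        pverts G = set us \<union> set p \<and> uedges G = cycle_edges us \<union> set (path_edges p))}"

definition J1 :: "nat \<Rightarrow> 'a pair_pre_digraph set" where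
  "J1 n = {G. connected_unicyclic G \<and> card (pverts G) = n \<and>
     (\<exists>us. ucycle G us \<and> length us = 6 \<and> card {T \<in> hanging_trees G us. nontrivial T} = 2) \<and>
     int (diam G) = int n - 3}"

end

theory Submission
  imports Defs
begin

text \<open>
  A connected unicyclic graph is its cycle together with a parent map on the other vertices. Give
  all tree edges and all non-leaf tree vertices private colors; leaves are never internal, so they
  cost nothing. With \<open>K\<close> colors on a cycle of length \<open>l\<close> and \<open>L\<close> leaves this uses \<open>2 (n - l) - L + K\<close>
  colors, and it remains to color the \<open>2 l\<close> vertices and edges of the cycle so that any two trees are
  joined by an arc without repeated colors. Reading the cycle as a cyclic word of length \<open>2 l\<close>, the word of period \<open>l\<close>
  works unless two opposite trees are nontrivial, and for even \<open>l\<close> the word of period \<open>l + 1\<close> always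
  works. For \<open>l \<le> 7\<close> with few leaves one saves further colors by reusing the colors of one or two pendant
  edges on the cycle: only paths ending in those leaves have to avoid them. Conversely a rainbow
  path of length \<open>D\<close> needs \<open>2 D - 1\<close> colors, and the exceptional graphs are those of diameter \<open>n - 3\<close>.
\<close>

section \<open>Rainbow paths, distances and cycles\<close>

text \<open>The count 2 (n - l) - L + K is at most 2 n - k exactly when K + k \<le> L + 2 l, and
  this inequality fixes every constant. For l = 6 a saving of 9 asks for K \<le> L + 3: the word of
  period 7 suffices from four leaves on, three leaves must manage with six cycle colors and two
  leaves with five. What remains is a single leaf, or two leaves over opposite cycle vertices. There
  the trees are bare paths, n is 6 plus the depths of the leaves, and two vertices lie at distance n
  - 3: the two leaves, or the leaf and the cycle vertex opposite its root. A rainbow path between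
  them shows 2 (n - 3) - 1 = 2 n - 7 colors, and a saving of 7 is always available. Since
  \<open>J1\<close> is given by its diameter, its lower bound needs no picture of the graph, while
  membership in it needs a bound on all distances.\<close>

lemma vwalk_arcs_eq_map: "vwalk_arcs p = map (\<lambda>i. (p ! i, p ! Suc i)) [0..<length p - 1]"
proof (induct p rule: vwalk_arcs.induct)
  case (3 x y xs)
  have "[0..<Suc (length xs)] = 0 # map Suc [0..<length xs]"
    by (subst upt_conv_Cons) (simp_all add: map_Suc_upt del: upt_Suc)
  then show ?case using 3 by (simp add: comp_def del: upt_Suc)
qed auto

lemma path_edges_eq_map: "path_edges p = map (\<lambda>i. {p ! i, p ! Suc i}) [0..<length p - 1]"
  by (simp add: path_edges_def vwalk_arcs_eq_map edge_of_def comp_def)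

lemma distinct_path_edges: "distinct p \<Longrightarrow> distinct (path_edges p)"
  by (auto simp: path_edges_eq_map distinct_map inj_on_def doubleton_eq_iff nth_eq_iff_index_eq)

lemma uedge_iff:
  assumes "pair_graph G"
  shows "{x, y} \<in> uedges G \<longleftrightarrow> (x, y) \<in> parcs G"
proof -
  interpret pair_graph G by fact
  show ?thesis
  proof
    assume "{x, y} \<in> uedges G"
    then obtain a b where "(a, b) \<in> parcs G" "{x, y} = {a, b}"
      by (auto simp: uedges_def edge_of_def)
    then show "(x, y) \<in> parcs G" using arcs_symmetric by (auto simp: doubleton_eq_iff)
  qed (auto simp: uedges_def edge_of_def image_iff intro: bexI[of _ "(x, y)"])
qed

text \<open>If the next vertex already lies on the path, the path is cut there, so it stays
  simple.\<close>

lemma path_in_rel: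
  assumes "(x, y) \<in> R\<^sup>*"
  shows "\<exists>p. p \<noteq> [] \<and> distinct p \<and> hd p = x \<and> last p = y \<and> set (vwalk_arcs p) \<subseteq> R
           \<and> set p \<subseteq> insert x (Field R)"
  using assms
proof (induction rule: rtrancl_induct)
  case base
  show ?case by (rule exI[of _ "[x]"]) auto
next
  case (step y z)
  then obtain p where p: "p \<noteq> []" "distinct p" "hd p = x" "last p = y"
    "set (vwalk_arcs p) \<subseteq> R" "set p \<subseteq> insert x (Field R)" by blast
  show ?case
  proof (cases "z \<in> set p")
    case True
    then obtain q r where q: "p = q @ z # r" by (meson split_list)
    have "set (vwalk_arcs (q @ [z])) \<subseteq> set (vwalk_arcs p)"
      using set_vwalk_arcs_append1[of "q @ [z]" r] q by simp
    then show ?thesis using p q by (intro exI[of _ "q @ [z]"]) (auto simp: hd_append)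
  next
    case False
    then show ?thesis using p step.hyps(2)
      by (intro exI[of _ "p @ [z]"]) (auto simp: vwalk_arcs_append Field_def)
  qed
qed

lemma set_internal_subset:
  assumes "distinct p"
  shows "set (butlast (tl p)) \<subseteq> set p - {hd p, last p}"
proof (cases p)
  case (Cons x q)
  show ?thesis
  proof (cases q rule: rev_cases)
    case (snoc r z)
    then show ?thesis using assms Cons by auto
  qed (simp add: Cons)
qed simp

lemma total_rainbow_if_inj_on:
  assumes "distinct p"
    and "inj_on c (Inl ` (set p - {hd p, last p}) \<union> Inr ` set (path_edges p))"
  shows "total_rainbow c p"
proof -
  have sub: "set (butlast (tl p)) \<subseteq> set p - {hd p, last p}"
    using set_internal_subset assms(1) by blast
  have inj: "inj_on c (Inl ` set (butlast (tl p)) \<union> Inr ` set (path_edges p))"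
    by (rule inj_on_subset[OF assms(2)]) (use sub in blast)
  have "inj_on (c \<circ> Inl) (set (butlast (tl p)))" "inj_on (c \<circ> Inr) (set (path_edges p))"
    by (rule comp_inj_on, simp, rule inj_on_subset[OF inj], blast)+
  then have d: "distinct (map (\<lambda>v. c (Inl v)) (butlast (tl p)))"
    "distinct (map (\<lambda>e. c (Inr e)) (path_edges p))"
    using assms(1) by (simp_all add: distinct_map comp_def distinct_tl distinct_butlast distinct_path_edges)
  have "c (Inl v) \<noteq> c (Inr e)"
    if "v \<in> set (butlast (tl p))" "e \<in> set (path_edges p)" for v e
    using inj_onD[OF inj, of "Inl v" "Inr e"] that by blast
  then have "set (map (\<lambda>v. c (Inl v)) (butlast (tl p))) \<inter> set (map (\<lambda>e. c (Inr e)) (path_edges p)) = {}"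
    by auto
  then show ?thesis
    unfolding total_rainbow_def distinct_append using d by (intro conjI)
qed

text \<open>Injectivity on everything in \<open>R\<close> passes to whichever path inside
  \<open>R\<close> is found, so a coloring is only ever checked on a subgraph. The two ends are
  exempt because they are not internal.\<close>

lemma rainbow_path_in_rel:
  assumes "pair_graph G" "R \<subseteq> parcs G" "(x, y) \<in> R\<^sup>*" "x \<in> pverts G"
    and inj: "inj_on c (Inl ` (Field R - {x, y}) \<union> Inr ` edge_of ` R)"
  shows "\<exists>p. vpath p G \<and> hd p = x \<and> last p = y \<and> total_rainbow c p"
proof -
  interpret pair_graph G by fact
  obtain p where p: "p \<noteq> []" "distinct p" "hd p = x" "last p = y"
    "set (vwalk_arcs p) \<subseteq> R" "set p \<subseteq> insert x (Field R)" using path_in_rel[OF assms(3)] by blast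
  have "Field R \<subseteq> pverts G"
    using assms(2) wellformed' unfolding Field_def by blast
  then have "set p \<subseteq> pverts G" using p(6) assms(4) by blast
  then have "vpath p G" using p(1,2,5) assms(2) by (simp add: vpath_def vwalk_def)
  moreover have "total_rainbow c p"
  proof (rule total_rainbow_if_inj_on[OF p(2)], rule inj_on_subset[OF inj])
    show "Inl ` (set p - {hd p, last p}) \<union> Inr ` set (path_edges p)
        \<subseteq> Inl ` (Field R - {x, y}) \<union> Inr ` edge_of ` R"
      unfolding p(3,4) path_edges_def set_map using p(3,4,5,6) by (intro Un_mono image_mono) blast+
  qed
  ultimately show ?thesis using p by blast
qed

text \<open>A path with D edges has D - 1 internal vertices, hence shows 2 D - 1 colors if it is
  total-rainbow.\<close>

lemma num_colors_ge:
  assumes "pair_graph G" "total_rainbow_connected G c" "u \<in> pverts G" "v \<in> pverts G" "u \<noteq> v"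
    and len: "\<And>p. vpath p G \<Longrightarrow> hd p = u \<Longrightarrow> last p = v \<Longrightarrow> D \<le> vwalk_length p"
  shows "2 * D \<le> num_colors G c + 1"
proof -
  interpret pair_graph G by fact
  obtain p where p: "vpath p G" "hd p = u" "last p = v" "total_rainbow c p"
    using assms(2-5) unfolding total_rainbow_connected_def by blast
  have D: "D + 1 \<le> length p" using len[OF p(1-3)] p(1) by (cases p) (auto simp: vpath_def vwalk_def)
  let ?cs = "map (\<lambda>v. c (Inl v)) (butlast (tl p)) @ map (\<lambda>e. c (Inr e)) (path_edges p)"
  have "set (butlast (tl p)) \<subseteq> pverts G"
    using p(1) set_internal_subset[of p] by (auto simp: vpath_def vwalk_def)
  moreover have "set (path_edges p) \<subseteq> uedges G"
    using p(1) by (auto simp: vpath_def vwalk_def path_edges_def uedges_def)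
  ultimately have "set ?cs \<subseteq> c ` (pverts G <+> uedges G)" by auto
  moreover have "finite (pverts G <+> uedges G)"
    by (simp add: uedges_def)
  ultimately have "card (set ?cs) \<le> num_colors G c"
    unfolding num_colors_def by (intro card_mono) auto
  moreover have "card (set ?cs) = length ?cs"
    using p(4) distinct_card unfolding total_rainbow_def by blast
  moreover have "length ?cs = (length p - 2) + (length p - 1)"
    by (simp add: path_edges_eq_map)
  ultimately show ?thesis using D by linarith
qed

lemma trc_le: "total_rainbow_connected G c \<Longrightarrow> trc G \<le> num_colors G c"
  unfolding trc_def by (rule Least_le) blast

lemma trc_attained:
  assumes "total_rainbow_connected G c"
  obtains c' where "total_rainbow_connected G c'" "num_colors G c' = trc G"
proof -
  have "\<exists>c'. total_rainbow_connected G c' \<and> num_colors G c' = trc G"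
    unfolding trc_def by (rule LeastI[of _ "num_colors G c"]) (use assms in blast)
  then show ?thesis using that by blast
qed

text \<open>A well chosen \<open>h\<close> replaces a case analysis over all paths between two
  vertices.\<close>

lemma vpath_potential:
  fixes G :: "'a pair_pre_digraph" and h :: "'a \<Rightarrow> int"
  assumes "vpath p G" and lip: "\<And>x y. (x, y) \<in> parcs G \<Longrightarrow> h y \<le> h x + 1"
  shows "h (last p) - h (hd p) \<le> int (vwalk_length p)"
proof -
  have "vwalk p (with_proj G)" using assms(1) by (auto simp: vpath_def)
  then show ?thesis
  proof (induct p rule: vwalk_induct)
    case (Cons u v es)
    then show ?case using lip[of u v] by simp
  qed simp
qed

lemma gdist_le:
  fixes G :: "'a pair_pre_digraph"
  shows "vpath p G \<Longrightarrow> gdist G (hd p) (last p) \<le> vwalk_length p"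
  unfolding gdist_def by (rule Least_le) blast

lemma gdist_attained:
  fixes G :: "'a pair_pre_digraph"
  assumes "vpath p G"
  obtains q where "vpath q G" "hd q = hd p" "last q = last p" "vwalk_length q = gdist G (hd p) (last p)"
proof -
  have "\<exists>q. vpath q G \<and> hd q = hd p \<and> last q = last p \<and> vwalk_length q = gdist G (hd p) (last p)"
    unfolding gdist_def by (rule LeastI[of _ "vwalk_length p"]) (use assms in blast)
  then show ?thesis using that by blast
qed

section \<open>Edge sets of cycles and their rotations\<close>

lemma cycle_edges_eq:
  assumes "us \<noteq> []"
  shows "cycle_edges us = (\<lambda>i. {us ! i, us ! (Suc i mod length us)}) ` {..<length us}"
proof -
  have *: "{..<length us} = insert (length us - 1) {0..<length us - 1}"
    using assms by (cases us) auto
  have "Suc (length us - 1) mod length us = 0" using assms by simp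
  then have "{us ! (length us - 1), us ! (Suc (length us - 1) mod length us)} = {last us, hd us}"
    using assms by (simp add: last_conv_nth hd_conv_nth)
  then show ?thesis
    unfolding * cycle_edges_def path_edges_eq_map by (auto simp: image_iff)
qed

lemma Union_cycle_edges: "us \<noteq> [] \<Longrightarrow> \<Union> (cycle_edges us) = set us"
proof (intro equalityI subsetI)
  assume us: "us \<noteq> []"
  { fix x assume "x \<in> \<Union> (cycle_edges us)"
    then obtain i where "i < length us" "x = us ! i \<or> x = us ! (Suc i mod length us)"
      by (auto simp: cycle_edges_eq[OF us])
    then show "x \<in> set us" using us by auto }
  { fix x assume "x \<in> set us"
    then obtain i where "i < length us" "x = us ! i" by (auto simp: in_set_conv_nth)
    then show "x \<in> \<Union> (cycle_edges us)" by (auto simp: cycle_edges_eq[OF us]) }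
qed

lemma cycle_edges_rotate: 
  assumes "us \<noteq> []"
  shows "cycle_edges (rotate k us) = cycle_edges us"
proof -
  let ?l = "length us"
  have "cycle_edges (rotate k us)
      = (\<lambda>i. {us ! ((k + i) mod ?l), us ! (Suc (k + i) mod ?l)}) ` {..<?l}"
    using assms by (subst cycle_edges_eq) (simp, rule image_cong, simp_all add: nth_rotate mod_add_right_eq)
  also have "\<dots> = (\<lambda>j. {us ! j, us ! (Suc j mod ?l)}) ` (\<lambda>i. (k + i) mod ?l) ` {..<?l}"
    by (simp add: image_image mod_Suc_eq)
  also have "(\<lambda>i. (k + i) mod ?l) ` {..<?l} = {..<?l}"
  proof (intro equalityI subsetI)
    fix j assume j: "j \<in> {..<?l}"
    \<comment> \<open>The preimage of j under the shift by k; k is reduced first so that the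
      truncated subtraction is exact.\<close>
    have "(k + (j + (?l - k mod ?l)) mod ?l) mod ?l = (k mod ?l + (j + (?l - k mod ?l))) mod ?l"
      by (simp only: mod_add_right_eq mod_add_left_eq)
    also have "k mod ?l + (j + (?l - k mod ?l)) = j + ?l"
      using mod_less_divisor[of ?l k] assms unfolding length_greater_0_conv by linarith
    finally have "j = (k + (j + (?l - k mod ?l)) mod ?l) mod ?l" using j by simp
    then show "j \<in> (\<lambda>i. (k + i) mod ?l) ` {..<?l}" using assms by (intro image_eqI) auto
  qed (use assms in auto)
  finally show ?thesis using assms by (simp add: cycle_edges_eq)
qed

section \<open>Unicyclic graphs as rooted forests on a cycle\<close>

text \<open>The description of all edges is postponed to \<open>unicyclic\<close>: proving it
  already uses the stems and cycle arcs available here. Strictly decreasing depth makes iterated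
  parents reach the cycle.\<close>

locale rooted_cycle =
  fixes G :: "'a pair_pre_digraph" and us :: "'a list" and parent :: "'a \<Rightarrow> 'a" and depth :: "'a \<Rightarrow> nat"
  assumes graph: "pair_graph G"
    and cyc: "ucycle G us"
    and parent_arc: "\<And>x. x \<in> pverts G - set us \<Longrightarrow> (x, parent x) \<in> parcs G"
    and depth_parent: "\<And>x. x \<in> pverts G - set us \<Longrightarrow> depth x = Suc (depth (parent x))"
    and depth_cycle: "\<And>x. x \<in> set us \<Longrightarrow> depth x = 0"
begin

definition root :: "'a \<Rightarrow> 'a" where "root x = (parent ^^ depth x) x"

definition ancestors :: "'a \<Rightarrow> 'a set" where "ancestors x = {(parent ^^ k) x | k. k \<le> depth x}"

definition leaves :: "'a set" where
  "leaves = (pverts G - set us) - parent ` (pverts G - set us)"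

definition stem :: "'a \<Rightarrow> 'a rel" where
  "stem x = (\<lambda>v. (v, parent v)) ` (ancestors x - set us) \<union> (\<lambda>v. (parent v, v)) ` (ancestors x - set us)"

text \<open>Indices run over all naturals and are reduced modulo the length, so an arc may pass the
  end of \<open>us\<close> without a case split. Both orientations are kept, so one relation serves
  both directions of travel.\<close>

definition cycle_arcs :: "nat \<Rightarrow> nat \<Rightarrow> 'a rel" where
  "cycle_arcs i m = (\<lambda>k. (us ! (k mod length us), us ! (Suc k mod length us))) ` {i..<i + m}
           \<union> (\<lambda>k. (us ! (Suc k mod length us), us ! (k mod length us))) ` {i..<i + m}"

lemma cycle_facts: "3 \<le> length us" "us \<noteq> []" "distinct us" "set us \<subseteq> pverts G"
  using cyc by (auto simp: ucycle_def vpath_def vwalk_def)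

lemma arcs_sym: "(x, y) \<in> parcs G \<Longrightarrow> (y, x) \<in> parcs G"
proof -
  interpret pair_graph G by (rule graph)
  show "(x, y) \<in> parcs G \<Longrightarrow> (y, x) \<in> parcs G" by (rule arcs_symmetric)
qed

lemma arcs_verts: "(x, y) \<in> parcs G \<Longrightarrow> x \<in> pverts G \<and> y \<in> pverts G"
proof -
  interpret pair_graph G by (rule graph)
  show "(x, y) \<in> parcs G \<Longrightarrow> x \<in> pverts G \<and> y \<in> pverts G" using wellformed' by blast
qed

lemma finite_verts: "finite (pverts G)"
proof -
  interpret pair_graph G by (rule graph)
  show ?thesis by simp
qed

lemma parent_in_verts: "x \<in> pverts G - set us \<Longrightarrow> parent x \<in> pverts G"
  using parent_arc arcs_verts by blast

lemma tree_induct [consumes 1, case_names cycle tree]: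
  assumes "x \<in> pverts G"
    and "\<And>x. x \<in> set us \<Longrightarrow> P x"
    and "\<And>x. x \<in> pverts G - set us \<Longrightarrow> P (parent x) \<Longrightarrow> P x"
  shows "P x"
  using assms(1)
proof (induction "depth x" arbitrary: x)
  case 0
  then show ?case using assms(2) depth_parent[of x] by auto
next
  case (Suc n)
  then have x: "x \<in> pverts G - set us" using depth_cycle[of x] by auto
  then show ?case using assms(3) Suc depth_parent[OF x] parent_in_verts[OF x] by auto
qed

lemma root_cycle [simp]: "x \<in> set us \<Longrightarrow> root x = x"
  by (simp add: root_def depth_cycle)

lemma root_parent: "x \<in> pverts G - set us \<Longrightarrow> root (parent x) = root x"
  by (simp add: root_def depth_parent funpow_swap1)

lemma ancestors_cycle: "x \<in> set us \<Longrightarrow> ancestors x = {x}"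
  by (simp add: ancestors_def depth_cycle)

lemma ancestors_tree:
  assumes "x \<in> pverts G - set us"
  shows "ancestors x = insert x (ancestors (parent x))"
proof -
  have "ancestors x = (\<lambda>k. (parent ^^ k) x) ` {..Suc (depth (parent x))}"
    using depth_parent[OF assms] by (auto simp: ancestors_def)
  also have "\<dots> = insert x ((\<lambda>k. (parent ^^ k) (parent x)) ` {..depth (parent x)})"
    by (simp add: atMost_Suc_eq_insert_0 image_image funpow_swap1)
  finally show ?thesis by (auto simp: ancestors_def)
qed

lemma self_in_ancestors: "x \<in> ancestors x"
  by (auto simp: ancestors_def intro: exI[of _ 0])

lemma root_in_cycle: "x \<in> pverts G \<Longrightarrow> root x \<in> set us"
  by (induct x rule: tree_induct) (auto simp: root_parent)

lemma ancestors_in_verts: "x \<in> pverts G \<Longrightarrow> ancestors x \<subseteq> pverts G"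
  by (induct x rule: tree_induct) (use cycle_facts in \<open>auto simp: ancestors_cycle ancestors_tree\<close>)

lemma ancestors_root: "x \<in> pverts G \<Longrightarrow> v \<in> ancestors x \<Longrightarrow> root v = root x"
  by (induct x rule: tree_induct) (auto simp: ancestors_cycle ancestors_tree root_parent)

lemma ancestors_Int_cycle: "x \<in> pverts G \<Longrightarrow> v \<in> ancestors x \<Longrightarrow> v \<in> set us \<Longrightarrow> v = root x"
  using ancestors_root root_cycle by metis

lemma root_in_ancestors: "x \<in> pverts G \<Longrightarrow> root x \<in> ancestors x"
  by (auto simp: root_def ancestors_def)

lemma parent_in_ancestors:
  "x \<in> pverts G \<Longrightarrow> v \<in> ancestors x - set us \<Longrightarrow> parent v \<in> ancestors x"
  by (induct x rule: tree_induct) (auto simp: ancestors_cycle ancestors_tree self_in_ancestors)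

text \<open>A stem meets a leaf only at its own start. This is why the color of a pendant edge can
  be lent to the cycle: only stems starting in that leaf contain the edge.\<close>

lemma ancestors_leaf: "x \<in> pverts G \<Longrightarrow> a \<in> ancestors x \<Longrightarrow> a \<in> leaves \<Longrightarrow> a = x"
proof (induct x rule: tree_induct)
  case (tree x)
  show ?case
  proof (rule ccontr)
    assume "a \<noteq> x"
    then have "a = parent x" using tree by (auto simp: ancestors_tree)
    then show False using tree by (auto simp: leaves_def)
  qed
qed (auto simp: ancestors_cycle)

lemma ancestors_depth: "x \<in> pverts G \<Longrightarrow> card (ancestors x - set us) = depth x"
proof (induct x rule: tree_induct)
  case (tree x)
  have "depth v \<le> depth (parent x)" if "v \<in> ancestors (parent x)" for v
    using parent_in_verts[OF tree(1)] that
    by (induct rule: tree_induct) (auto simp: ancestors_cycle ancestors_tree depth_parent)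
  then have "x \<notin> ancestors (parent x)" using depth_parent[OF tree(1)] by fastforce
  moreover have "finite (ancestors (parent x))"
    using finite_subset[OF ancestors_in_verts finite_verts] parent_in_verts[OF tree(1)] by blast
  ultimately show ?case
    using tree depth_parent[OF tree(1)] by (simp add: ancestors_tree insert_Diff_if)
qed (simp add: ancestors_cycle depth_cycle)

lemma sym_stem: "sym (stem x)"
  unfolding stem_def sym_def by blast

lemma sym_arc: "sym (cycle_arcs i m)"
  unfolding cycle_arcs_def sym_def by blast

lemma Field_stem: "x \<in> pverts G \<Longrightarrow> Field (stem x) \<subseteq> ancestors x"
  using parent_in_ancestors by (auto simp: stem_def Field_def)

lemma edges_stem: "edge_of ` stem x = (\<lambda>v. {v, parent v}) ` (ancestors x - set us)"
  by (auto simp: stem_def edge_of_def image_Un image_image insert_commute)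

lemma stem_subset: "x \<in> pverts G \<Longrightarrow> stem x \<subseteq> parcs G"
  using ancestors_in_verts[of x] parent_arc arcs_sym[OF parent_arc] unfolding stem_def by blast

lemma stem_connects: "x \<in> pverts G \<Longrightarrow> (x, root x) \<in> (stem x)\<^sup>*"
proof (induct x rule: tree_induct)
  case (tree x)
  have "stem (parent x) \<subseteq> stem x" "(x, parent x) \<in> stem x"
    using tree(1) by (auto simp: stem_def ancestors_tree)
  then show ?case
    using tree root_parent[OF tree(1)] by (metis converse_rtrancl_into_rtrancl in_mono rtrancl_mono)
qed simp

lemma edges_arc:
  "edge_of ` cycle_arcs i m = (\<lambda>k. {us ! (k mod length us), us ! (Suc k mod length us)}) ` {i..<i + m}"
  by (auto simp: cycle_arcs_def edge_of_def image_Un image_image insert_commute)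

lemma Field_arc: "Field (cycle_arcs i m) \<subseteq> (\<lambda>k. us ! (k mod length us)) ` {i..i + m}"
proof -
  have "us ! (k mod length us) \<in> (\<lambda>k. us ! (k mod length us)) ` {i..i + m}"
    "us ! (Suc k mod length us) \<in> (\<lambda>k. us ! (k mod length us)) ` {i..i + m}" if "k \<in> {i..<i + m}" for k
    using that by (intro imageI; simp)+
  then show ?thesis unfolding cycle_arcs_def Field_def by blast
qed

lemma cycle_arc: "(us ! (k mod length us), us ! (Suc k mod length us)) \<in> parcs G"
proof -
  let ?l = "length us"
  have "k mod ?l < ?l" using cycle_facts by simp
  show ?thesis
  proof (cases "Suc (k mod ?l) < ?l")
    case True
    then have "(us ! (k mod ?l), us ! Suc (k mod ?l)) \<in> set (vwalk_arcs us)"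
      by (auto simp: vwalk_arcs_eq_map)
    moreover have "Suc k mod ?l = Suc (k mod ?l)" using True by (simp add: mod_Suc)
    ultimately show ?thesis using cyc by (auto simp: ucycle_def vpath_def vwalk_def)
  next
    case False
    then have "Suc k mod ?l = 0" "k mod ?l = ?l - 1"
      using \<open>k mod ?l < ?l\<close> by (auto simp: mod_Suc)
    then show ?thesis using cyc cycle_facts(2) by (simp add: ucycle_def last_conv_nth hd_conv_nth)
  qed
qed

lemma arc_subset: "cycle_arcs i m \<subseteq> parcs G"
  using cycle_arc arcs_sym by (auto simp: cycle_arcs_def)

lemma arc_connects: "(us ! (i mod length us), us ! ((i + m) mod length us)) \<in> (cycle_arcs i m)\<^sup>*"
proof (induct m)
  case (Suc m)
  have "cycle_arcs i m \<subseteq> cycle_arcs i (Suc m)"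
    "(us ! ((i + m) mod length us), us ! ((i + Suc m) mod length us)) \<in> cycle_arcs i (Suc m)"
    by (auto simp: cycle_arcs_def)
  then show ?case using Suc by (meson rtrancl.rtrancl_into_rtrancl rtrancl_mono subsetD)
qed simp

text \<open>A deepest vertex having \<open>x\<close> as an ancestor cannot be the parent of
  anything.\<close>

lemma ex_leaf_above:
  assumes "x \<in> pverts G - set us"
  shows "\<exists>a\<in>leaves. x \<in> ancestors a"
proof -
  let ?A = "{y \<in> pverts G - set us. x \<in> ancestors y}"
  have "finite ?A" "x \<in> ?A" using finite_verts assms self_in_ancestors by auto
  then have "Max (depth ` ?A) \<in> depth ` ?A" by (intro Max_in) auto
  then obtain y where y: "y \<in> ?A" "depth y = Max (depth ` ?A)" by auto
  have "y \<notin> parent ` (pverts G - set us)"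
  proof
    assume "y \<in> parent ` (pverts G - set us)"
    then obtain z where z: "z \<in> pverts G - set us" "y = parent z" by blast
    then have "z \<in> ?A" using y(1) ancestors_tree[OF z(1)] by simp
    then have "depth z \<le> depth y" unfolding y(2) using \<open>finite ?A\<close> by (intro Max_ge) auto
    then show False using depth_parent[OF z(1)] z(2) by simp
  qed
  then show ?thesis using y(1) by (auto simp: leaves_def)
qed

end

locale unicyclic = rooted_cycle +
  assumes edges: "uedges G = cycle_edges us \<union> (\<lambda>x. {x, parent x}) ` (pverts G - set us)"

lemma unique_cycle_edges:
  assumes "connected_unicyclic G" "ucycle G us" "ucycle G vs"
  shows "cycle_edges us = cycle_edges vs"
proof -
  obtain C where C: "\<forall>D. (\<exists>us. ucycle G us \<and> D = cycle_edges us) \<longrightarrow> D = C"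
    using assms(1) unfolding connected_unicyclic_def by (elim conjE ex1E) blast
  then have "cycle_edges us = C" "cycle_edges vs = C" using assms(2,3) by auto
  then show ?thesis by simp
qed

text \<open>
  The parent of a vertex is a neighbor closer to the cycle. Any further edge would close a second
  cycle with a path along cycle edges and parent edges.
\<close>

lemma connected_unicyclic_structure:
  assumes "connected_unicyclic G" "ucycle G us"
  shows "\<exists>parent depth. unicyclic G us parent depth"
proof -
  have pg: "pair_graph G" and conn: "Digraph_Component.connected (with_proj G)"
    using assms(1) unfolding connected_unicyclic_def by auto
  interpret pair_graph G by (rule pg)
  have us: "us \<noteq> []" "set us \<subseteq> pverts G" using assms(2) by (auto simp: ucycle_def vpath_def vwalk_def)
  have reach: "(x, y) \<in> (parcs G)\<^sup>*" if "x \<in> pverts G" "y \<in> pverts G" for x y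
  proof -
    have "strongly_connected (with_proj G)"
      using symmetric_connected_imp_strongly_connected[OF pair_sym_arcs conn] .
    then have "x \<rightarrow>\<^sup>*\<^bsub>with_proj G\<^esub> y" using that by (auto simp: strongly_connected_def)
    then show ?thesis by (metis reachable_def rtrancl_on_rtranclI with_proj_simps(3))
  qed
  define D where "D x = (LEAST k. \<exists>u\<in>set us. (x, u) \<in> parcs G ^^ k)" for x
  have ex: "\<exists>k. \<exists>u\<in>set us. (x, u) \<in> parcs G ^^ k" if "x \<in> pverts G" for x
    using reach[OF that, of "hd us"] us by (metis hd_in_set rtrancl_imp_relpow subsetD)
  have D: "\<exists>u\<in>set us. (x, u) \<in> parcs G ^^ D x" if "x \<in> pverts G" for x
    unfolding D_def by (rule LeastI_ex[OF ex[OF that]])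
  have D_le: "D x \<le> k" if "u \<in> set us" "(x, u) \<in> parcs G ^^ k" for x u k
    unfolding D_def by (rule Least_le) (use that in blast)
  have D0: "D x = 0" if "x \<in> set us" for x using D_le[of x x 0] that by simp
  have "\<exists>y. (x, y) \<in> parcs G \<and> D x = Suc (D y)" if x: "x \<in> pverts G - set us" for x
  proof -
    obtain u where u: "u \<in> set us" "(x, u) \<in> parcs G ^^ D x" using D x by blast
    then obtain k where k: "D x = Suc k" using x by (cases "D x") auto
    then obtain y where y: "(x, y) \<in> parcs G" "(y, u) \<in> parcs G ^^ k"
      using u(2) by (metis relpow_Suc_D2)
    obtain w where w: "w \<in> set us" "(y, w) \<in> parcs G ^^ D y" using D in_arcsD2 y by blast
    have "D x \<le> Suc (D y)" using D_le[OF w(1)] relpow_Suc_I2[OF y(1) w(2)] by blast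
    moreover have "D y \<le> k" using D_le[OF u(1) y(2)] .
    ultimately show ?thesis using k y by auto
  qed
  then obtain f where f: "\<And>x. x \<in> pverts G - set us \<Longrightarrow> (x, f x) \<in> parcs G \<and> D x = Suc (D (f x))"
    by metis
  interpret r: rooted_cycle G us f D
    by (rule rooted_cycle.intro) (use pg assms(2) f D0 in simp_all)
  have arcs: "(x, y) \<in> parcs G" if "{x, y} \<in> cycle_edges us \<union> (\<lambda>x. {x, f x}) ` (pverts G - set us)" for x y
  proof -
    have "{x, y} \<in> uedges G"
      using that
    proof
      assume "{x, y} \<in> cycle_edges us"
      then obtain i where "i < length us" "{x, y} = {us ! i, us ! (Suc i mod length us)}"
        using cycle_edges_eq[OF us(1)] by auto
      then show ?thesis using r.cycle_arc[of i] uedge_iff[OF pg] by simp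
    next
      assume "{x, y} \<in> (\<lambda>x. {x, f x}) ` (pverts G - set us)"
      then obtain z where "z \<in> pverts G - set us" "{x, y} = {z, f z}" by blast
      then show ?thesis using f uedge_iff[OF pg, of z "f z"] by simp
    qed
    then show ?thesis using uedge_iff[OF pg] by blast
  qed
  let ?E = "cycle_edges us \<union> (\<lambda>x. {x, f x}) ` (pverts G - set us)"
  define R where "R = {(x, y). {x, y} \<in> ?E}"
  have "sym R" unfolding sym_def R_def by (simp add: insert_commute)
  then have sR: "sym (R\<^sup>*)" by (rule sym_rtrancl)
  have stem: "(x, r.root x) \<in> R\<^sup>*" if "x \<in> pverts G" for x
  proof -
    have "r.stem x \<subseteq> R"
      using r.ancestors_in_verts[OF that] by (auto simp: r.stem_def insert_commute R_def)
    then show ?thesis using r.stem_connects[OF that] rtrancl_mono by blast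
  qed
  have "r.cycle_arcs 0 m \<subseteq> R" for m
  proof -
    have "{us ! (k mod length us), us ! (Suc k mod length us)} \<in> cycle_edges us" for k
      unfolding cycle_edges_eq[OF us(1)]
      by (rule image_eqI[of _ _ "k mod length us"]) (use us in \<open>auto simp: mod_Suc_eq\<close>)
    then show ?thesis by (auto simp: r.cycle_arcs_def insert_commute R_def)
  qed
  then have "(us ! 0, us ! (m mod length us)) \<in> R\<^sup>*" for m
    using r.arc_connects[of 0 m] rtrancl_mono[of "r.cycle_arcs 0 m" R] by auto
  then have arc: "(us ! 0, u) \<in> R\<^sup>*" if "u \<in> set us" for u
    using that by (metis in_set_conv_nth mod_less)
  have conn: "(x, y) \<in> R\<^sup>*" if "x \<in> pverts G" "y \<in> pverts G" for x y
  proof -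
    have "(us ! 0, x) \<in> R\<^sup>*" if "x \<in> pverts G" for x
      using rtrancl_trans[OF arc[OF r.root_in_cycle[OF that]] symD[OF sR stem[OF that]]] .
    then show ?thesis using that rtrancl_trans[OF symD[OF sR]] by blast
  qed
  have "e \<in> ?E" if eG: "e \<in> uedges G" for e
  proof (rule ccontr)
    assume e: "e \<notin> ?E"
    obtain x y where xy: "e = {x, y}" "(x, y) \<in> parcs G"
      using eG by (metis edge_of_def imageE prod.collapse uedges_def)
    then have V: "x \<in> pverts G" "y \<in> pverts G" "x \<noteq> y" using in_arcsD1 in_arcsD2 no_loops' by auto
    obtain p where p: "p \<noteq> []" "distinct p" "hd p = x" "last p = y"
      "set (vwalk_arcs p) \<subseteq> R" "set p \<subseteq> insert x (Field R)"
      using path_in_rel[OF conn[OF V(1,2)]] by blast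
    have R: "R \<subseteq> parcs G" using arcs unfolding R_def by blast
    then have "Field R \<subseteq> pverts G" using in_arcsD1 in_arcsD2 unfolding Field_def by blast
    then have "set p \<subseteq> pverts G" using p(6) V by blast
    moreover have "set (vwalk_arcs p) \<subseteq> parcs G" using p(5) R by (rule subset_trans)
    ultimately have "vpath p G" using p(1,2) by (simp add: vpath_def vwalk_def)
    \<comment> \<open>A path with a single edge would put the supposed extra edge \<open>e\<close>
      itself into \<open>R\<close>.\<close>
    moreover have "3 \<le> length p"
    proof (rule ccontr)
      assume "\<not> 3 \<le> length p"
      then consider a where "p = [a]" | a b where "p = [a, b]"
        using p(1) by (cases p; cases "tl p") (auto simp: Suc_le_eq)
      then show False
      proof cases
        case 1
        then show False using p(3,4) V(3) by simp
      next
        case 2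
        then have "(x, y) \<in> R" using p(3-5) by simp
        then show False using e xy(1) by (simp add: R_def)
      qed
    qed
    ultimately have "ucycle G p" using p xy arcs_symmetric by (auto simp: ucycle_def)
    then have "cycle_edges p = cycle_edges us" using unique_cycle_edges assms by blast
    moreover have "e \<in> cycle_edges p" using p xy by (simp add: cycle_edges_def insert_commute)
    ultimately show False using e by blast
  qed
  moreover have "e \<in> uedges G" if eE: "e \<in> ?E" for e
  proof -
    consider i where "e = {us ! i, us ! (Suc i mod length us)}" | z where "e = {z, f z}"
      using eE unfolding cycle_edges_eq[OF us(1)] by blast
    then obtain x y where xy: "e = {x, y}" by cases
    then have "(x, y) \<in> parcs G" using arcs eE by simp
    then show ?thesis using uedge_iff[OF pg] xy by simp
  qed
  ultimately have "uedges G = ?E" by (intro equalityI subsetI)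
  then have "unicyclic G us f D"
    by (intro unicyclic.intro unicyclic_axioms.intro r.rooted_cycle_axioms)
  then show ?thesis by blast
qed

section \<open>Total-colorings from a coloring of the cycle\<close>

text \<open>
  Positions on the cycle: \<open>2 i\<close> stands for the \<open>i\<close>-th vertex and \<open>2 i + 1\<close> for the edge after it,
  both modulo \<open>2 l\<close>. The span is the arc running forward from vertex \<open>i\<close> to vertex \<open>j\<close>; an open end
  omits the end vertex, because there the path starts on the cycle itself. In \<open>arc_good\<close> and
  \<open>arc_ok\<close> the tag \<open>None\<close> marks such an open end, while \<open>Some c\<close> is the color of the pendant edge
  leading to the end of the path, which must not reappear on the arc.
\<close>

definition arc_span :: "nat \<Rightarrow> nat \<Rightarrow> bool \<Rightarrow> nat \<Rightarrow> bool \<Rightarrow> nat set" where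
  "arc_span l i open_i j open_j =
     {2 * i + (if open_i then 1 else 0)..<2 * (i + (j + l - i) mod l) + (if open_j then 0 else 1)}"

definition arc_good ::
    "(nat \<Rightarrow> nat) \<Rightarrow> nat \<Rightarrow> nat \<Rightarrow> nat option \<Rightarrow> nat \<Rightarrow> nat option \<Rightarrow> bool" where
  "arc_good f l i s j t \<longleftrightarrow>
     inj_on (\<lambda>p. f (p mod (2 * l))) (arc_span l i (s = None) j (t = None)) \<and>
     (\<forall>p \<in> arc_span l i (s = None) j (t = None). s \<noteq> Some (f (p mod (2 * l))) \<and> t \<noteq> Some (f (p mod (2 * l))))"

context unicyclic
begin

definition cyc_elem :: "nat \<Rightarrow> 'a + 'a set" where
  "cyc_elem p = (if even p then Inl (us ! (p div 2 mod length us))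
     else Inr {us ! (p div 2 mod length us), us ! (Suc (p div 2) mod length us)})"

lemma cyc_elem_vertex: "cyc_elem (2 * k) = Inl (us ! (k mod length us))"
  by (simp add: cyc_elem_def)

lemma cyc_elem_edge: "cyc_elem (2 * k + 1) = Inr {us ! (k mod length us), us ! (Suc k mod length us)}"
  by (simp add: cyc_elem_def)

lemma cyc_elem_mod: "cyc_elem (p mod (2 * length us)) = cyc_elem p"
proof -
  have "p mod (2 * length us) div 2 = p div 2 mod length us"
    using mod_mult2_eq[of p 2 "length us"] by (simp add: div_mult2_eq)
  moreover have "even (p mod (2 * length us)) = even p"
    by (metis dvd_mod_iff dvd_triv_left)
  moreover have "Suc (p div 2 mod length us) mod length us = Suc (p div 2) mod length us"
    by (rule mod_Suc_eq)
  ultimately show ?thesis by (simp add: cyc_elem_def)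
qed

text \<open>Two indices with the same edge would each be the cyclic successor of the other, which
  happens only on a cycle of length two.\<close>

lemma inj_cyc_edges: "inj_on (\<lambda>k. {us ! k, us ! (Suc k mod length us)}) {..<length us}"
proof (rule inj_onI)
  fix j k
  assume jk: "j \<in> {..<length us}" "k \<in> {..<length us}"
    and eq: "{us ! j, us ! (Suc j mod length us)} = {us ! k, us ! (Suc k mod length us)}"
  have l: "3 \<le> length us" "distinct us" using cycle_facts by auto
  have s: "Suc j mod length us < length us" "Suc k mod length us < length us"
    using cycle_facts(2) by auto
  show "j = k"
  proof (rule ccontr)
    assume "j \<noteq> k"
    then have "us ! j \<noteq> us ! k" using jk l by (simp add: nth_eq_iff_index_eq)
    then have "us ! j = us ! (Suc k mod length us)" "us ! k = us ! (Suc j mod length us)"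
      using eq by (auto simp: doubleton_eq_iff)
    then have "j = Suc k mod length us" "k = Suc j mod length us"
      using jk s l by (auto simp: nth_eq_iff_index_eq)
    moreover have succ: "q mod length us = 0 \<and> q = length us \<or> q mod length us = q" if "q \<le> length us" for q
      using that by (cases "q = length us") auto
    ultimately have "j = 0 \<and> Suc k = length us \<or> j = Suc k" "k = 0 \<and> Suc j = length us \<or> k = Suc j"
      using succ[of "Suc k"] succ[of "Suc j"] jk by (metis Suc_leI lessThan_iff)+
    then show False using l(1) by (elim disjE conjE; linarith)
  qed
qed

lemma inj_cyc_elem: "inj_on cyc_elem {..<2 * length us}"
proof (rule inj_onI)
  fix p q
  assume pq: "p \<in> {..<2 * length us}" "q \<in> {..<2 * length us}" and eq: "cyc_elem p = cyc_elem q"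
  have lt: "p div 2 < length us" "q div 2 < length us" using pq by auto
  have par: "even p = even q" using eq by (auto simp: cyc_elem_def split: if_splits)
  have "p div 2 = q div 2"
  proof (cases "even p")
    case True
    then show ?thesis using eq par lt cycle_facts by (simp add: cyc_elem_def nth_eq_iff_index_eq)
  next
    case False
    then show ?thesis using eq par lt inj_onD[OF inj_cyc_edges, of "p div 2" "q div 2"]
      by (simp add: cyc_elem_def)
  qed
  then show "p = q" using par by (metis dvd_mult_div_cancel odd_two_times_div_two_succ)
qed

lemma inj_tree_edges: "inj_on (\<lambda>v. {v, parent v}) (pverts G - set us)"
proof (rule inj_onI)
  fix v w
  assume vw: "v \<in> pverts G - set us" "w \<in> pverts G - set us" "{v, parent v} = {w, parent w}"
  show "v = w"
  proof (rule ccontr)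
    assume "v \<noteq> w"
    then have "v = parent w" "w = parent v" using vw(3) by (auto simp: doubleton_eq_iff)
    then show False using depth_parent[OF vw(1)] depth_parent[OF vw(2)] by simp
  qed
qed

text \<open>The three prescriptions cannot clash: every tree edge contains a tree vertex, cycle
  elements contain none, and within each group the enumeration is injective and can be
  inverted.\<close>

lemma ex_coloring:
  fixes f :: "nat \<Rightarrow> nat" and g h :: "'a \<Rightarrow> nat"
  obtains c where "\<And>p. c (cyc_elem p) = f (p mod (2 * length us))"
    and "\<And>v. v \<in> pverts G - set us \<Longrightarrow> c (Inl v) = g v"
    and "\<And>v. v \<in> pverts G - set us \<Longrightarrow> c (Inr {v, parent v}) = h v"
proof -
  let ?P = "{..<2 * length us}"
  define c where "c z = (if z \<in> cyc_elem ` ?P then f (the_inv_into ?P cyc_elem z)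
    else case z of Inl v \<Rightarrow> g v | Inr e \<Rightarrow> h (the_inv_into (pverts G - set us) (\<lambda>v. {v, parent v}) e))" for z
  have sub: "us ! (k mod length us) \<in> set us" for k using cycle_facts by simp
  have "c (cyc_elem p) = f (p mod (2 * length us))" for p
  proof -
    have "p mod (2 * length us) \<in> ?P" using cycle_facts by simp
    moreover have "c (cyc_elem q) = f q" if "q \<in> ?P" for q
      using that the_inv_into_f_f[OF inj_cyc_elem that] by (simp add: c_def)
    ultimately show ?thesis by (metis cyc_elem_mod)
  qed
  moreover have "c (Inl v) = g v" if "v \<in> pverts G - set us" for v
  proof -
    have "Inl v \<noteq> cyc_elem p" for p using that sub by (auto simp: cyc_elem_def)
    then show ?thesis by (auto simp: c_def)
  qed
  moreover have "c (Inr {v, parent v}) = h v" if "v \<in> pverts G - set us" for v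
  proof -
    have "{v, parent v} \<noteq> {us ! (k mod length us), us ! (Suc k mod length us)}" for k
      using that sub[of k] sub[of "Suc k"] by (metis DiffD2 insertE insertI1 singletonD)
    then have "Inr {v, parent v} \<noteq> cyc_elem p" for p by (auto simp: cyc_elem_def)
    then show ?thesis using the_inv_into_f_f[OF inj_tree_edges that] by (auto simp: c_def)
  qed
  ultimately show ?thesis using that by blast
qed

lemma card_leaves_le: "card leaves \<le> card (pverts G - set us)"
  by (rule card_mono) (auto simp: finite_verts leaves_def)

text \<open>Color layout, with m tree vertices: the cycle uses colors below K, tree edges K +
  \<open>idx\<close>, inner tree vertices K + m + \<open>idx\<close>, leaves 0. A cycle edge may
  borrow the color of a leaf's pendant edge; \<open>tag\<close> gives the color an arc has to avoid
  at that end. Cycle vertices must stay below K, because a root is internal on paths inside its own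
  tree, where there is no choice between two arcs.\<close>

lemma ex_rainbow_coloring:
  fixes f :: "nat \<Rightarrow> nat" and idx :: "'a \<Rightarrow> nat" and K :: nat
  defines "tag \<equiv> \<lambda>x. if x \<in> set us then None else Some (K + idx x)"
  assumes idx: "inj_on idx (pverts G - set us)"
      "\<And>v. v \<in> pverts G - set us \<Longrightarrow> idx v < card (pverts G - set us)"
    and K: "0 < K"
    and f_vertex: "\<And>i. i < length us \<Longrightarrow> f (2 * i) < K"
    and f_edge: "\<And>p. p < 2 * length us \<Longrightarrow> f p < K \<or> (\<exists>a\<in>leaves. f p = K + idx a)"
    and arcs: "\<And>x y i j. x \<in> pverts G \<Longrightarrow> y \<in> pverts G \<Longrightarrow> i < length us \<Longrightarrow> j < length us \<Longrightarrow>
      root x = us ! i \<Longrightarrow> root y = us ! j \<Longrightarrow> i \<noteq> j \<Longrightarrow>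
      arc_good f (length us) i (tag x) j (tag y) \<or> arc_good f (length us) j (tag y) i (tag x)"
  shows "\<exists>c. total_rainbow_connected G c \<and>
    num_colors G c + card leaves \<le> K + 2 * card (pverts G - set us)"
proof -
  let ?l = "length us" and ?T = "pverts G - set us"
  let ?m = "card ?T"
  define F where "F p = f (p mod (2 * ?l))" for p
  obtain c where c_cyc: "\<And>p. c (cyc_elem p) = F p"
    and c_vert: "\<And>v. v \<in> ?T \<Longrightarrow> c (Inl v) = (if v \<in> leaves then 0 else K + ?m + idx v)"
    and c_edge: "\<And>v. v \<in> ?T \<Longrightarrow> c (Inr {v, parent v}) = K + idx v"
    using ex_coloring[of f "\<lambda>v. if v \<in> leaves then 0 else K + ?m + idx v" "\<lambda>v. K + idx v"]
    unfolding F_def by blast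
  have lpos: "0 < ?l" using cycle_facts by simp
  have F: "F p < K \<or> (\<exists>a\<in>leaves. F p = K + idx a)" for p
    unfolding F_def using f_edge lpos by simp
  have F_vertex: "F (2 * k) < K" for k
    unfolding F_def using f_vertex[of "k mod ?l"] lpos by (simp add: mod_mult_mult1)
  have leaves_T: "leaves \<subseteq> ?T" by (auto simp: leaves_def)
  \<comment> \<open>One check for all pairs of ends: a set P of cycle positions together with both
    stems.\<close>
  have inj_parts: "inj_on c (cyc_elem ` P \<union> (Inl ` (A - set us - {x, y}) \<union> Inr ` (\<lambda>v. {v, parent v}) ` (A - set us)))"
    if x: "x \<in> pverts G" and y: "y \<in> pverts G" and A: "A = ancestors x \<union> ancestors y"
      and P: "inj_on F P" "\<And>p. p \<in> P \<Longrightarrow> tag x \<noteq> Some (F p) \<and> tag y \<noteq> Some (F p)"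
    for x y A P
  proof -
    have AT: "A - set us \<subseteq> ?T" using A ancestors_in_verts[OF x] ancestors_in_verts[OF y] by blast
    have nl: "v \<notin> leaves" if "v \<in> A" "v \<noteq> x" "v \<noteq> y" for v
      using that A ancestors_leaf[OF x] ancestors_leaf[OF y] by blast
    have cv: "c (Inl v) = K + ?m + idx v" if "v \<in> A - set us - {x, y}" for v
      using c_vert[of v] nl[of v] that AT by auto
    have ce: "c (Inr {v, parent v}) = K + idx v" if "v \<in> A - set us" for v
      using c_edge[of v] that AT by auto
    let ?W1 = "cyc_elem ` P" and ?W2 = "Inl ` (A - set us - {x, y}) :: ('a + 'a set) set"
      and ?W3 = "Inr ` (\<lambda>v. {v, parent v}) ` (A - set us) :: ('a + 'a set) set"
    have idxA: "v = w" if "v \<in> A - set us" "w \<in> A - set us" "idx v = idx w" for v w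
      using inj_onD[OF idx(1) that(3)] that(1,2) AT by blast
    have i1: "inj_on c ?W1"
      by (rule inj_on_imageI) (use P(1) c_cyc in \<open>simp add: inj_on_def\<close>)
    have i2: "inj_on c ?W2"
      by (rule inj_on_imageI, rule inj_onI) (use cv idxA in auto)
    have i3: "inj_on c ?W3"
      unfolding image_image by (rule inj_on_imageI, rule inj_onI) (use ce idxA in auto)
    have d23: "c z \<noteq> c w" if z: "z \<in> ?W2" and w: "w \<in> ?W3" for z w
    proof -
      obtain v where v: "z = Inl v" "v \<in> A - set us - {x, y}" using z by blast
      obtain u where u: "w = Inr {u, parent u}" "u \<in> A - set us" using w by blast
      have "idx u < ?m" using idx(2)[of u] u AT by blast
      then show ?thesis using cv[OF v(2)] ce[OF u(2)] v(1) u(1) by simp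
    qed
    have d1: "c z \<noteq> c w" if z: "z \<in> ?W1" and w: "w \<in> ?W2 \<union> ?W3" for z w
    proof -
      obtain p where p: "z = cyc_elem p" "p \<in> P" using z by blast
      \<comment> \<open>Even a borrowed color lies below K + m and so misses the inner tree
        vertices.\<close>
      have Fm: "F p < K + ?m" using F[of p] idx(2) leaves_T by (auto simp: subset_iff)
      show ?thesis using w
      proof
        assume "w \<in> ?W2"
        then obtain v where v: "w = Inl v" "v \<in> A - set us - {x, y}" by blast
        then show ?thesis using cv[OF v(2)] Fm p c_cyc by simp
      next
        assume "w \<in> ?W3"
        then obtain u where u: "w = Inr {u, parent u}" "u \<in> A - set us" by blast
        show ?thesis
        proof
          assume "c z = c w"
          then have Fu: "F p = K + idx u" using ce[OF u(2)] u(1) p c_cyc by simp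
          \<comment> \<open>A borrowed color found on a stem belongs to a leaf, and that leaf can
            only be \<open>x\<close> or \<open>y\<close>, whose tags P avoids.\<close>
          then obtain a where a: "a \<in> leaves" "F p = K + idx a" using F[of p] by auto
          then have "a = u" using inj_onD[OF idx(1), of a u] Fu leaves_T u(2) AT by auto
          then have "u = x \<or> u = y" using a(1) nl u(2) by blast
          then have "tag x = Some (F p) \<or> tag y = Some (F p)" using u(2) Fu by (auto simp: tag_def)
          then show False using P(2)[OF p(2)] by blast
        qed
      qed
    qed
    have i23: "inj_on c (?W2 \<union> ?W3)"
      unfolding inj_on_Un using i2 i3 d23 by blast
    show ?thesis
      by (subst inj_on_Un) (use i1 i23 d1 in blast)
  qed
  have joined_arc: "\<exists>R. R \<subseteq> parcs G \<and> sym R \<and> (x, y) \<in> R\<^sup>* \<and>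
      inj_on c (Inl ` (Field R - {x, y}) \<union> Inr ` edge_of ` R)"
    if x: "x \<in> pverts G" and y: "y \<in> pverts G" and ij: "i < ?l" "j < ?l"
      and rx: "root x = us ! i" and ry: "root y = us ! j"
      and good: "arc_good f ?l i (tag x) j (tag y)" for x y i j
  proof -
    define k where "k = (j + ?l - i) mod ?l"
    let ?A = "ancestors x \<union> ancestors y"
    define P where "P = arc_span ?l i (tag x = None) j (tag y = None)"
    define R where "R = stem x \<union> cycle_arcs i k \<union> stem y"
    have P_eq: "P = {2 * i + (if x \<in> set us then 1 else 0)..<2 * (i + k) + (if y \<in> set us then 0 else 1)}"
      by (simp add: P_def arc_span_def k_def tag_def)
    have ik: "(i + k) mod ?l = j" unfolding k_def using ij by (simp add: mod_add_right_eq)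
    have "R \<subseteq> parcs G" using stem_subset[OF x] stem_subset[OF y] arc_subset unfolding R_def by blast
    moreover have "sym R" unfolding R_def by (intro sym_Un sym_stem sym_arc)
    moreover have "(x, y) \<in> R\<^sup>*"
    proof -
      have "(x, us ! i) \<in> R\<^sup>*"
        using stem_connects[OF x] rtrancl_mono[of "stem x" R] unfolding R_def rx by blast
      moreover have "(us ! i, us ! j) \<in> R\<^sup>*"
        using arc_connects[of i k] rtrancl_mono[of "cycle_arcs i k" R] ik ij unfolding R_def by auto
      moreover have "(us ! j, y) \<in> R\<^sup>*"
        using symD[OF sym_rtrancl[OF sym_stem] stem_connects[OF y]] rtrancl_mono[of "stem y" R]
        unfolding R_def ry by blast
      ultimately show ?thesis by (meson rtrancl_trans)
    qed
    moreover have "inj_on c (Inl ` (Field R - {x, y}) \<union> Inr ` edge_of ` R)"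
    proof (rule inj_on_subset[OF inj_parts[OF x y refl, of P]])
      show "inj_on F P" "\<And>p. p \<in> P \<Longrightarrow> tag x \<noteq> Some (F p) \<and> tag y \<noteq> Some (F p)"
        using good unfolding arc_good_def F_def P_def by auto
      \<comment> \<open>If an end lies on the cycle, P omits its position; the same vertex is then
        excluded as an end of the path, so the two omissions agree.\<close>
      have cv: "Inl v \<in> cyc_elem ` P" if v: "v \<noteq> x" "v \<noteq> y" "v = us ! (q mod ?l)" "i \<le> q" "q \<le> i + k" for v q
      proof -
        have "q \<noteq> i" if "x \<in> set us" using that v rx ij by auto
        moreover have "q \<noteq> i + k" if "y \<in> set us" using that v ry ik by auto
        ultimately have "2 * q \<in> P" using v(4,5) unfolding P_eq by auto
        then show ?thesis using v(3) cyc_elem_vertex[of q] by (metis imageI)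
      qed
      have vs: "Inl v \<in> cyc_elem ` P \<union> Inl ` (?A - set us - {x, y})" if v: "v \<in> Field R - {x, y}" for v
      proof (cases "v \<in> set us")
        case True
        have "v \<in> ?A \<union> (\<lambda>k. us ! (k mod ?l)) ` {i..i + k}"
          using v Field_stem[OF x] Field_stem[OF y] Field_arc[of i k] unfolding R_def Field_Un by blast
        then consider "v = root x" | "v = root y" | q where "v = us ! (q mod ?l)" "i \<le> q" "q \<le> i + k"
          using True ancestors_Int_cycle[OF x] ancestors_Int_cycle[OF y] by auto
        then show ?thesis
        proof cases
          case 1 then show ?thesis using cv[of v i] v rx ij by simp
        next
          case 2 then show ?thesis using cv[of v "i + k"] v ry ik by simp
        next
          case 3 then show ?thesis using cv[of v q] v by blast
        qed
      next
        case False
        have "v \<notin> (\<lambda>k. us ! (k mod ?l)) ` {i..i + k}" using False lpos by auto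
        then have "v \<in> ?A"
          using v Field_stem[OF x] Field_stem[OF y] Field_arc[of i k] unfolding R_def Field_Un by blast
        then show ?thesis using False v by blast
      qed
      have es: "Inr e \<in> cyc_elem ` P" if e: "e \<in> edge_of ` cycle_arcs i k" for e
      proof -
        obtain q where q: "e = {us ! (q mod ?l), us ! (Suc q mod ?l)}" "i \<le> q" "q < i + k"
          using e unfolding edges_arc by auto
        then have "2 * q + 1 \<in> P" unfolding P_eq by auto
        then show ?thesis using q(1) cyc_elem_edge[of q] by (metis imageI)
      qed
      have er: "edge_of ` R = edge_of ` cycle_arcs i k \<union> (\<lambda>v. {v, parent v}) ` (?A - set us)"
        unfolding R_def image_Un edges_stem Un_Diff by blast
      have "Inr ` edge_of ` cycle_arcs i k \<subseteq> cyc_elem ` P" by (rule image_subsetI[OF es])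
      moreover have "Inl ` (Field R - {x, y}) \<subseteq> cyc_elem ` P \<union> Inl ` (?A - set us - {x, y})"
        by (rule image_subsetI[OF vs])
      moreover have "A \<subseteq> P \<union> B \<Longrightarrow> E \<subseteq> P \<Longrightarrow> A \<union> (E \<union> C) \<subseteq> P \<union> (B \<union> C)"
        for A B C E P :: "('a + 'a set) set" by blast
      ultimately show "Inl ` (Field R - {x, y}) \<union> Inr ` edge_of ` R \<subseteq>
          cyc_elem ` P \<union> (Inl ` (?A - set us - {x, y}) \<union> Inr ` (\<lambda>v. {v, parent v}) ` (?A - set us))"
        unfolding er image_Un by (simp only:)
    qed
    ultimately show ?thesis by blast
  qed
  \<comment> \<open>Both stems run up to the common root even if they meet earlier; the shorter
    simple path is left to \<open>rainbow_path_in_rel\<close>.\<close>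
  have joined_tree: "\<exists>R. R \<subseteq> parcs G \<and> sym R \<and> (x, y) \<in> R\<^sup>* \<and>
      inj_on c (Inl ` (Field R - {x, y}) \<union> Inr ` edge_of ` R)"
    if x: "x \<in> pverts G" and y: "y \<in> pverts G" and ij: "i < ?l"
      and rx: "root x = us ! i" and ry: "root y = us ! i" for x y i
  proof -
    let ?A = "ancestors x \<union> ancestors y"
    define R where "R = stem x \<union> stem y"
    have "R \<subseteq> parcs G" using stem_subset[OF x] stem_subset[OF y] unfolding R_def by blast
    moreover have "sym R" unfolding R_def by (intro sym_Un sym_stem)
    moreover have "(x, y) \<in> R\<^sup>*"
    proof -
      have "(x, us ! i) \<in> R\<^sup>*"
        using stem_connects[OF x] rtrancl_mono[of "stem x" R] unfolding R_def rx by blast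
      moreover have "(us ! i, y) \<in> R\<^sup>*"
        using symD[OF sym_rtrancl[OF sym_stem] stem_connects[OF y]] rtrancl_mono[of "stem y" R]
        unfolding R_def ry by blast
      ultimately show ?thesis by (rule rtrancl_trans)
    qed
    moreover have "inj_on c (Inl ` (Field R - {x, y}) \<union> Inr ` edge_of ` R)"
    proof (rule inj_on_subset[OF inj_parts[OF x y refl, of "{2 * i}"]])
      show "inj_on F {2 * i}" by simp
      show "tag x \<noteq> Some (F p) \<and> tag y \<noteq> Some (F p)" if "p \<in> {2 * i}" for p
        using that F_vertex[of i] by (auto simp: tag_def)
      have vs: "Inl v \<in> cyc_elem ` {2 * i} \<union> Inl ` (?A - set us - {x, y})" if v: "v \<in> Field R - {x, y}" for v
      proof -
        have A: "v \<in> ?A"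
          using v Field_stem[OF x] Field_stem[OF y] unfolding R_def Field_Un by blast
        show ?thesis
        proof (cases "v \<in> set us")
          case True
          then have "v = us ! i" using A ancestors_Int_cycle[OF x] ancestors_Int_cycle[OF y] rx ry by auto
          then show ?thesis using cyc_elem_vertex[of i] ij by simp
        qed (use A v in blast)
      qed
      have er: "edge_of ` R = (\<lambda>v. {v, parent v}) ` (?A - set us)"
        unfolding R_def image_Un edges_stem Un_Diff by blast
      have "Inl ` (Field R - {x, y}) \<subseteq> cyc_elem ` {2 * i} \<union> Inl ` (?A - set us - {x, y})"
        by (rule image_subsetI[OF vs])
      moreover have "A \<subseteq> P \<union> B \<Longrightarrow> A \<union> C \<subseteq> P \<union> (B \<union> C)"
        for A B C P :: "('a + 'a set) set" by blast
      ultimately show "Inl ` (Field R - {x, y}) \<union> Inr ` edge_of ` R \<subseteq>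
          cyc_elem ` {2 * i} \<union> (Inl ` (?A - set us - {x, y}) \<union> Inr ` (\<lambda>v. {v, parent v}) ` (?A - set us))"
        unfolding er by (simp only:)
    qed
    ultimately show ?thesis by blast
  qed
  have "total_rainbow_connected G c"
    unfolding total_rainbow_connected_def
  proof (intro ballI impI)
    fix x y assume x: "x \<in> pverts G" and y: "y \<in> pverts G" and "x \<noteq> y"
    obtain i where i: "i < ?l" "root x = us ! i" using root_in_cycle[OF x] by (metis in_set_conv_nth)
    obtain j where j: "j < ?l" "root y = us ! j" using root_in_cycle[OF y] by (metis in_set_conv_nth)
    have "\<exists>R. R \<subseteq> parcs G \<and> sym R \<and> (x, y) \<in> R\<^sup>* \<and> inj_on c (Inl ` (Field R - {x, y}) \<union> Inr ` edge_of ` R)"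
    proof (cases "i = j")
      case True
      then show ?thesis using joined_tree[OF x y i(1) i(2)] j(2) by simp
    next
      case False
      then consider "arc_good f ?l i (tag x) j (tag y)" | "arc_good f ?l j (tag y) i (tag x)"
        using arcs[OF x y i(1) j(1) i(2) j(2)] by blast
      then show ?thesis
      proof cases
        case 1
        then show ?thesis using joined_arc[OF x y i(1) j(1) i(2) j(2)] by blast
      next
        case 2
        then obtain R where R: "R \<subseteq> parcs G" "sym R" "(y, x) \<in> R\<^sup>*"
          "inj_on c (Inl ` (Field R - {y, x}) \<union> Inr ` edge_of ` R)"
          using joined_arc[OF y x j(1) i(1) j(2) i(2)] by blast
        then have "(x, y) \<in> R\<^sup>*" using symD[OF sym_rtrancl] by metis
        then show ?thesis using R by (intro exI[of _ R]) (simp add: insert_commute)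
      qed
    qed
    then show "\<exists>p. vpath p G \<and> hd p = x \<and> last p = y \<and> total_rainbow c p"
      using rainbow_path_in_rel[OF graph] x by blast
  qed
  moreover have "num_colors G c + card leaves \<le> K + 2 * ?m"
  proof -
    \<comment> \<open>The leaf color 0 is already a cycle color, since 0 < K; hence only the m - L
      inner vertices appear in the last block.\<close>
    define U where "U = {..<K} \<union> (\<lambda>v. K + idx v) ` ?T \<union> (\<lambda>v. K + ?m + idx v) ` (?T - leaves)"
    have cyc_in: "c (cyc_elem p) \<in> U" for p
    proof -
      have "F p \<in> U" using F[of p]
      proof
        assume "\<exists>a\<in>leaves. F p = K + idx a"
        then show ?thesis using leaves_T unfolding U_def by blast
      qed (simp add: U_def)
      then show ?thesis using c_cyc[of p] by simp
    qed
    have "c (Inl v) \<in> U" if "v \<in> pverts G" for v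
    proof (cases "v \<in> set us")
      case True
      then obtain k where "k < ?l" "v = us ! k" by (metis in_set_conv_nth)
      then show ?thesis using cyc_in[of "2 * k"] cyc_elem_vertex[of k] by simp
    next
      case False
      then show ?thesis using c_vert[of v] that K by (simp add: U_def)
    qed
    moreover have "c (Inr e) \<in> U" if "e \<in> uedges G" for e
    proof -
      have "e \<in> cycle_edges us \<or> e \<in> (\<lambda>x. {x, parent x}) ` ?T" using that unfolding edges Un_iff .
      then show ?thesis
      proof
        assume "e \<in> cycle_edges us"
        then obtain k where k: "k < ?l" "e = {us ! k, us ! (Suc k mod ?l)}"
          using cycle_edges_eq[OF cycle_facts(2)] by auto
        then have "Inr e = cyc_elem (2 * k + 1)" using cyc_elem_edge[of k] by simp
        then show ?thesis using cyc_in[of "2 * k + 1"] by (simp only:)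
      next
        assume "e \<in> (\<lambda>x. {x, parent x}) ` ?T"
        then obtain v where "v \<in> ?T" "e = {v, parent v}" by blast
        then show ?thesis using c_edge[of v] unfolding U_def by blast
      qed
    qed
    ultimately have sub: "c ` (pverts G <+> uedges G) \<subseteq> U"
      by (intro image_subsetI) (elim PlusE, simp_all)
    have fin: "finite U" using finite_verts by (simp add: U_def)
    have "num_colors G c \<le> card U"
      unfolding num_colors_def by (rule card_mono[OF fin sub])
    moreover have "card U \<le> card ({..<K} \<union> (\<lambda>v. K + idx v) ` ?T) + card ((\<lambda>v. K + ?m + idx v) ` (?T - leaves))"
      unfolding U_def by (rule card_Un_le)
    moreover have "card ({..<K} \<union> (\<lambda>v. K + idx v) ` ?T) \<le> card {..<K} + card ((\<lambda>v. K + idx v) ` ?T)"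
      by (rule card_Un_le)
    moreover have "card ((\<lambda>v. K + idx v) ` ?T) \<le> ?m"
      "card ((\<lambda>v. K + ?m + idx v) ` (?T - leaves)) \<le> card (?T - leaves)"
      using finite_verts by (simp_all add: card_image_le)
    moreover have "card (?T - leaves) = ?m - card leaves"
      using finite_verts leaves_T by (intro card_Diff_subset finite_subset[OF leaves_T]) auto
    ultimately show ?thesis using card_leaves_le card_lessThan[of K] by linarith
  qed
  ultimately show ?thesis by blast
qed

end

section \<open>Coloring schemes\<close>

text \<open>Executable form of \<open>arc_good\<close> for a word given as a list, so that concrete
  words can be verified by evaluation.\<close>

definition arc_ok ::
    "nat list \<Rightarrow> nat \<Rightarrow> nat \<Rightarrow> nat option \<Rightarrow> nat \<Rightarrow> nat option \<Rightarrow> bool" where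
  "arc_ok xs l i s j t \<longleftrightarrow>
     (let cs = map (\<lambda>p. xs ! (p mod (2 * l)))
        [2 * i + (if s = None then 1 else 0)..<2 * (i + (j + l - i) mod l) + (if t = None then 0 else 1)]
      in distinct cs \<and> s \<notin> Some ` set cs \<and> t \<notin> Some ` set cs)"

text \<open>
  The word \<open>xs\<close> colors the positions of the cycle. Colors below \<open>K\<close> are fresh, \<open>K + k\<close> is the color
  of the pendant edge of the \<open>k\<close>-th of \<open>s\<close> selected leaves, and \<open>K + s\<close> stands for the edge
  above any other tree vertex. The list \<open>ys ! i\<close> contains the tags that may occur in the tree at
  position \<open>i\<close>.
\<close>

definition scheme_ok :: "nat list \<Rightarrow> nat \<Rightarrow> nat \<Rightarrow> nat \<Rightarrow> nat list list \<Rightarrow> bool" where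
  "scheme_ok xs l K s ys \<longleftrightarrow>
     (\<forall>p\<in>set [0..<2 * l]. xs ! p < K + s) \<and> (\<forall>i\<in>set [0..<l]. xs ! (2 * i) < K) \<and>
     (\<forall>i\<in>set [0..<l]. \<forall>j\<in>set [0..<l]. i \<noteq> j \<longrightarrow>
       (\<forall>s\<in>set (None # map Some (ys ! i)). \<forall>t\<in>set (None # map Some (ys ! j)).
          arc_ok xs l i s j t \<or> arc_ok xs l j t i s))"

lemma arc_good_if_arc_ok: "arc_ok xs l i s j t \<Longrightarrow> arc_good ((!) xs) l i s j t"
  by (auto simp: arc_ok_def arc_good_def arc_span_def Let_def distinct_map image_iff)

text \<open>A tag matters only by being open or by coinciding with a color of the word. All tree
  vertices whose pendant color is not borrowed can therefore share one tag.\<close>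

lemma arc_good_cong_tags:
  assumes "arc_good f l i s j t" "s' = None \<longleftrightarrow> s = None" "t' = None \<longleftrightarrow> t = None"
    and "\<And>p. s' = Some (f (p mod (2 * l))) \<Longrightarrow> s = s'" "\<And>p. t' = Some (f (p mod (2 * l))) \<Longrightarrow> t = t'"
  shows "arc_good f l i s' j t'"
proof -
  have "s' \<noteq> Some (f (p mod (2 * l))) \<and> t' \<noteq> Some (f (p mod (2 * l)))"
    if "p \<in> arc_span l i (s = None) j (t = None)" for p
    using assms(1) assms(4,5)[of p] that unfolding arc_good_def by auto
  then show ?thesis using assms(1) unfolding arc_good_def assms(2,3) by blast
qed

section \<open>Words of period l and l + 1\<close>

lemma inj_on_mod:
  fixes a b l :: nat
  assumes "b \<le> a + l"
  shows "inj_on (\<lambda>p. p mod l) {a..<b}"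
proof (rule linorder_inj_onI')
  fix p q assume pq: "p \<in> {a..<b}" "q \<in> {a..<b}" "p < q"
  show "p mod l \<noteq> q mod l"
  proof
    assume "p mod l = q mod l"
    then have "l dvd q - p" using pq(3) by (metis less_imp_le mod_eq_dvd_iff_nat)
    then have "l \<le> q - p" using pq(3) by (intro dvd_imp_le) auto
    then show False using pq assms by auto
  qed
qed

lemma arc_lengths_add:
  fixes i j l :: nat
  assumes "i < l" "j < l" "i \<noteq> j"
  shows "(j + l - i) mod l + (i + l - j) mod l = l"
proof (cases "i < j")
  case True
  then have "(j + l - i) mod l = j - i" "(i + l - j) mod l = i + l - j"
    using assms by (auto simp: mod_if)
  then show ?thesis using True assms by simp
next
  case False
  then have "(j + l - i) mod l = j + l - i" "(i + l - j) mod l = i - j"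
    using assms by (auto simp: mod_if)
  then show ?thesis using False assms by simp
qed

text \<open>An arc of a edges covers 2 a - 1 positions plus one for each closed end, and any l
  consecutive positions have distinct colors; l divides 2 l, so the word closes up without a seam.
  The shorter arc fits, except when 2 a = l and both ends are closed, which \<open>opp\<close>
  excludes.\<close>

lemma arc_good_period:
  assumes ij: "i < l" "j < l" "i \<noteq> j"
    and tags: "\<And>c. s = Some c \<Longrightarrow> l \<le> c" "\<And>c. t = Some c \<Longrightarrow> l \<le> c"
    and opp: "s = None \<or> t = None \<or> 2 * ((j + l - i) mod l) \<noteq> l"
  shows "arc_good (\<lambda>p. p mod l) l i s j t \<or> arc_good (\<lambda>p. p mod l) l j t i s"
proof -
  have F: "p mod (2 * l) mod l = p mod l" for p :: nat by (simp add: mod_mod_cancel)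
  have lt: "p mod l < l" for p using ij by simp
  have good: "arc_good (\<lambda>p. p mod l) l i s j t"
    if "2 * ((j + l - i) mod l) + (if s = None then 0 else 1) + (if t = None then 0 else 1) \<le> l + 1"
      "\<And>c. s = Some c \<Longrightarrow> l \<le> c" "\<And>c. t = Some c \<Longrightarrow> l \<le> c" for i j s t
    unfolding arc_good_def F
  proof
    show "inj_on (\<lambda>p. p mod l) (arc_span l i (s = None) j (t = None))"
      unfolding arc_span_def by (rule inj_on_mod) (use that(1) in \<open>auto split: if_splits\<close>)
    show "\<forall>p\<in>arc_span l i (s = None) j (t = None). s \<noteq> Some (p mod l) \<and> t \<noteq> Some (p mod l)"
      using that(2,3) lt by (meson not_le)
  qed
  let ?a = "(j + l - i) mod l" and ?b = "(i + l - j) mod l"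
  have "?a + ?b = l" using arc_lengths_add[OF ij] .
  then consider "2 * ?a + 1 \<le> l" | "2 * ?b + 1 \<le> l" | "2 * ?a = l" by linarith
  then show ?thesis
  proof cases
    case 1
    then have "2 * ?a + (if s = None then 0 else 1) + (if t = None then 0 else 1) \<le> l + 1" by simp
    then show ?thesis using good[OF _ tags] by blast
  next
    case 2
    then have "2 * ?b + (if t = None then 0 else 1) + (if s = None then 0 else 1) \<le> l + 1" by simp
    then show ?thesis using good[OF _ tags(2,1)] by blast
  next
    case 3
    then have "2 * ?a + (if s = None then 0 else 1) + (if t = None then 0 else 1) \<le> l + 1"
      using opp by auto
    then show ?thesis using good[OF _ tags] by blast
  qed
qed

text \<open>Now l + 1 consecutive positions are distinct, which suits opposite trees, but l + 1 does
  not divide 2 l and position 0 becomes a seam. Of two opposite arcs the one starting at the smaller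
  index avoids the seam; shorter arcs may cross it, having at least two edge or vertex positions to
  spare.\<close>

lemma arc_good_period_Suc:
  assumes ij: "i < l" "j < l" "i \<noteq> j" and ev: "even l"
    and tags: "\<And>c. s = Some c \<Longrightarrow> l + 1 \<le> c" "\<And>c. t = Some c \<Longrightarrow> l + 1 \<le> c"
  shows "arc_good (\<lambda>p. p mod (l + 1)) l i s j t \<or> arc_good (\<lambda>p. p mod (l + 1)) l j t i s"
proof -
  let ?F = "\<lambda>p. p mod (2 * l) mod (l + 1)"
  have lt: "?F p < l + 1" for p by simp
  have good: "arc_good (\<lambda>p. p mod (l + 1)) l i s j t"
    if i: "i < l" and short: "2 * ((j + l - i) mod l) + 2 \<le> l \<or> 2 * ((j + l - i) mod l) \<le> l \<and> i + (j + l - i) mod l < l"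
      and tg: "\<And>c. s = Some c \<Longrightarrow> l + 1 \<le> c" "\<And>c. t = Some c \<Longrightarrow> l + 1 \<le> c" for i j s t
  proof -
    let ?a = "(j + l - i) mod l"
    have ne: "?F p \<noteq> ?F q" if p: "2 * i \<le> p" "p < q" "q \<le> 2 * (i + ?a)" for p q
    proof -
      have mod_ne: "x mod (l + 1) \<noteq> y mod (l + 1)" if "x < y" "y \<le> x + l" for x y
        using inj_onD[OF inj_on_mod[of "y + 1" x "l + 1"], of x y] that by auto
      have qp: "q \<le> p + l" using p short by auto
      have ub: "q < 4 * l" using p i short by auto
      consider "q < 2 * l" | "2 * l \<le> p" | "p < 2 * l" "2 * l \<le> q" by linarith
      then show ?thesis
      proof cases
        case 1
        then show ?thesis using mod_ne[of p q] p qp by simp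
      next
        case 2
        then have "p mod (2 * l) = p - 2 * l" "q mod (2 * l) = q - 2 * l"
          using p ub by (auto simp: mod_if)
        then show ?thesis using mod_ne[of "p - 2 * l" "q - 2 * l"] p qp 2 by simp
      next
        case 3
        \<comment> \<open>Across the seam the residues are p - (l + 1) and q - 2 l. They differ
          because q - p is at most l - 2, less than the jump of l - 1 at the seam.\<close>
        then have s2: "2 * ?a + 2 \<le> l" using short p by auto
        then have lp: "l + 1 \<le> p" and "q + (l + 1) < p + 2 * l" using p 3 i by simp_all
        then have bounds: "l + 1 \<le> p" "q - 2 * l < p - (l + 1)" using 3(2) by simp_all
        have "q mod (2 * l) = q - 2 * l" using 3 ub by (auto simp: mod_if)
        moreover have "q - 2 * l < l + 1" using bounds 3 by linarith
        moreover have "p mod (l + 1) = p - (l + 1)" using bounds(1) 3 by (auto simp: mod_if)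
        ultimately show ?thesis using 3(1) bounds by simp
      qed
    qed
    show ?thesis unfolding arc_good_def
    proof
      show "inj_on ?F (arc_span l i (s = None) j (t = None))"
        by (rule linorder_inj_onI') (use ne in \<open>auto simp: arc_span_def split: if_splits\<close>)
      show "\<forall>p\<in>arc_span l i (s = None) j (t = None). s \<noteq> Some (?F p) \<and> t \<noteq> Some (?F p)"
        using tg lt by (meson not_le)
    qed
  qed
  let ?a = "(j + l - i) mod l" and ?b = "(i + l - j) mod l"
  have ab: "?a + ?b = l" using arc_lengths_add[OF ij] .
  obtain h where h: "l = 2 * h" using ev by (elim evenE)
  consider "2 * ?a + 2 \<le> l" | "2 * ?b + 2 \<le> l" | "?a = h" "?b = h"
    using ab h by linarith
  then show ?thesis
  proof cases
    case 1
    then show ?thesis using good[OF ij(1) _ tags] by blast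
  next
    case 2
    then show ?thesis using good[OF ij(2) _ tags(2,1)] by blast
  next
    case 3
    show ?thesis
    proof (cases "i < j")
      case True
      then have "?a = j - i" using ij by (auto simp: mod_if)
      then show ?thesis using good[OF ij(1) _ tags] 3 h True ij by auto
    next
      case False
      then have "?b = i - j" using ij by (auto simp: mod_if)
      then show ?thesis using good[OF ij(2) _ tags(2,1)] 3 h False ij by auto
    qed
  qed
qed

text \<open>Selected leaves get the first indices, hence the first pendant colors. When
  \<open>as\<close> exhausts A, \<open>idx\<close> is an inverse of list lookup.\<close>

lemma ex_index:
  assumes "finite A" "distinct as" "set as \<subseteq> A"
  obtains idx :: "'a \<Rightarrow> nat" where "inj_on idx A" "\<And>v. v \<in> A \<Longrightarrow> idx v < card A"
    "\<And>k. k < length as \<Longrightarrow> idx (as ! k) = k"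
proof -
  obtain bs where bs: "set bs = A - set as" "distinct bs"
    using finite_distinct_list[of "A - set as"] assms(1) by auto
  define zs where "zs = as @ bs"
  have zs: "distinct zs" "set zs = A" using bs assms by (auto simp: zs_def)
  then have len: "length zs = card A" using distinct_card by metis
  let ?idx = "the_inv_into {..<length zs} ((!) zs)"
  have bij: "bij_betw ((!) zs) {..<length zs} A" using zs by (simp add: bij_betw_nth)
  then have inj: "inj_on ((!) zs) {..<length zs}" and im: "(!) zs ` {..<length zs} = A"
    by (auto simp: bij_betw_def)
  show ?thesis
  proof (rule that[of ?idx])
    show "inj_on ?idx A" using inj_on_the_inv_into[OF inj] im by simp
    show "?idx v < card A" if "v \<in> A" for v
      using the_inv_into_into[OF inj, of v "{..<length zs}"] that im len by simp
    show "?idx (as ! k) = k" if "k < length as" for k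
      using the_inv_into_f_f[OF inj, of k] that by (simp add: zs_def nth_append)
  qed
qed

context unicyclic
begin

lemma coloring_period:
  assumes "\<And>x y i j. x \<in> pverts G - set us \<Longrightarrow> y \<in> pverts G - set us \<Longrightarrow> i < length us \<Longrightarrow>
    j < length us \<Longrightarrow> root x = us ! i \<Longrightarrow> root y = us ! j \<Longrightarrow>
    2 * ((j + length us - i) mod length us) \<noteq> length us"
  shows "\<exists>c. total_rainbow_connected G c \<and>
    num_colors G c + card leaves \<le> length us + 2 * card (pverts G - set us)"
proof -
  obtain idx :: "'a \<Rightarrow> nat" where idx: "inj_on idx (pverts G - set us)"
    "\<And>v. v \<in> pverts G - set us \<Longrightarrow> idx v < card (pverts G - set us)"
    using ex_index[of "pverts G - set us" "[]"] finite_verts by auto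
  have lpos: "0 < length us" using cycle_facts by simp
  show ?thesis
  proof (rule ex_rainbow_coloring[OF idx lpos, of "\<lambda>p. p mod length us"])
    fix x y i j
    assume "x \<in> pverts G" "y \<in> pverts G" "i < length us" "j < length us"
      "root x = us ! i" "root y = us ! j" "i \<noteq> j"
    then show "arc_good (\<lambda>p. p mod length us) (length us) i (if x \<in> set us then None else Some (length us + idx x))
        j (if y \<in> set us then None else Some (length us + idx y)) \<or>
      arc_good (\<lambda>p. p mod length us) (length us) j (if y \<in> set us then None else Some (length us + idx y))
        i (if x \<in> set us then None else Some (length us + idx x))"
      using assms[of x y i j] by (intro arc_good_period) (auto split: if_splits)
  qed (use lpos in auto)
qed

lemma coloring_period_Suc:
  assumes "even (length us)"
  shows "\<exists>c. total_rainbow_connected G c \<and>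
    num_colors G c + card leaves \<le> length us + 1 + 2 * card (pverts G - set us)"
proof -
  obtain idx :: "'a \<Rightarrow> nat" where idx: "inj_on idx (pverts G - set us)"
    "\<And>v. v \<in> pverts G - set us \<Longrightarrow> idx v < card (pverts G - set us)"
    using ex_index[of "pverts G - set us" "[]"] finite_verts by auto
  have lpos: "0 < length us + 1" by simp
  show ?thesis
  proof (rule ex_rainbow_coloring[OF idx lpos, of "\<lambda>p. p mod (length us + 1)"])
    fix x y i j
    assume "x \<in> pverts G" "y \<in> pverts G" "i < length us" "j < length us"
      "root x = us ! i" "root y = us ! j" "i \<noteq> j"
    then show "arc_good (\<lambda>p. p mod (length us + 1)) (length us) i (if x \<in> set us then None else Some (length us + 1 + idx x))
        j (if y \<in> set us then None else Some (length us + 1 + idx y)) \<or>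
      arc_good (\<lambda>p. p mod (length us + 1)) (length us) j (if y \<in> set us then None else Some (length us + 1 + idx y))
        i (if x \<in> set us then None else Some (length us + 1 + idx x))"
      using assms by (intro arc_good_period_Suc) (auto split: if_splits)
  qed auto
qed

lemma coloring_scheme:
  assumes K: "0 < K" and as: "distinct as" "set as \<subseteq> leaves"
    and ok: "scheme_ok xs (length us) K (length as) ys"
    and special: "\<And>k. k < length as \<Longrightarrow> \<exists>i<length us. root (as ! k) = us ! i \<and> K + k \<in> set (ys ! i)"
    and generic: "\<And>x. x \<in> pverts G - set us \<Longrightarrow>
      \<exists>i<length us. root x = us ! i \<and> K + length as \<in> set (ys ! i)"
  shows "\<exists>c. total_rainbow_connected G c \<and>
    num_colors G c + card leaves \<le> K + 2 * card (pverts G - set us)"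
proof -
  let ?l = "length us" and ?T = "pverts G - set us" and ?s = "length as"
  have asT: "set as \<subseteq> ?T" using as(2) by (auto simp: leaves_def)
  obtain idx :: "'a \<Rightarrow> nat" where idx: "inj_on idx ?T" "\<And>v. v \<in> ?T \<Longrightarrow> idx v < card ?T"
    "\<And>k. k < ?s \<Longrightarrow> idx (as ! k) = k"
    using ex_index[OF _ as(1) asT] finite_verts by (metis finite_Diff)
  define tag where "tag x = (if x \<in> set us then None else Some (K + idx x))" for x
  \<comment> \<open>Truncation at \<open>?s\<close> merges all unselected vertices into one tag. It
    is harmless since the word only uses colors below K + \<open>?s\<close>.\<close>
  define code where "code x = (if x \<in> set us then None else Some (K + min ?s (idx x)))" for x
  have lpos: "0 < ?l" using cycle_facts by simp
  have xs: "xs ! p < K + ?s" if "p < 2 * ?l" for p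
    using ok that unfolding scheme_ok_def set_upt by (meson atLeastLessThan_iff zero_le)
  have index_eq: "i = j" if "us ! i = us ! j" "i < ?l" "j < ?l" for i j
    using that cycle_facts(3) by (simp add: nth_eq_iff_index_eq)
  have code_in: "code x \<in> set (None # map Some (ys ! i))" if x: "x \<in> pverts G" and i: "i < ?l" "root x = us ! i" for x i
  proof (cases "x \<in> set us")
    case False
    show ?thesis
    proof (cases "x \<in> set as")
      case True
      then obtain k where "k < ?s" "x = as ! k" by (metis in_set_conv_nth)
      moreover obtain i' where "i' < ?l" "root (as ! k) = us ! i'" "K + k \<in> set (ys ! i')"
        using special[OF \<open>k < ?s\<close>] by blast
      ultimately have "K + k \<in> set (ys ! i)" using index_eq[of i i'] i by auto
      then show ?thesis using \<open>k < ?s\<close> \<open>x = as ! k\<close> idx(3)[of k] False by (simp add: code_def)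
    next
      case nas: False
      have "\<not> idx x < ?s"
      proof
        assume "idx x < ?s"
        then have "idx (as ! idx x) = idx x" "as ! idx x \<in> set as" using idx(3) by auto
        then show False using inj_onD[OF idx(1), of "as ! idx x" x] asT x False nas by auto
      qed
      moreover obtain i' where "i' < ?l" "root x = us ! i'" "K + ?s \<in> set (ys ! i')"
        using generic x False by blast
      then have "K + ?s \<in> set (ys ! i)" using index_eq[of i i'] i by auto
      ultimately show ?thesis using False by (simp add: code_def)
    qed
  qed (simp add: code_def)
  have code_tag: "code x = tag x" if "tag x = Some (xs ! (p mod (2 * ?l)))" for x p
    using that xs[of "p mod (2 * ?l)"] lpos by (auto simp: code_def tag_def split: if_splits)
  have None_iff: "tag x = None \<longleftrightarrow> code x = None" for x by (simp add: tag_def code_def)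
  have tag_good: "arc_good ((!) xs) ?l i (tag x) j (tag y)" if "arc_ok xs ?l i (code x) j (code y)" for x y i j
    by (rule arc_good_cong_tags[OF arc_good_if_arc_ok[OF that] None_iff None_iff]) (use code_tag in auto)
  have ok': "arc_ok xs ?l i s j t \<or> arc_ok xs ?l j t i s"
    if "i < ?l" "j < ?l" "i \<noteq> j" "s \<in> set (None # map Some (ys ! i))" "t \<in> set (None # map Some (ys ! j))"
    for i j s t
    using ok that unfolding scheme_ok_def set_upt by (meson atLeastLessThan_iff zero_le)
  show ?thesis
  proof (rule ex_rainbow_coloring[OF idx(1,2) K, of "(!) xs"])
    show "xs ! (2 * i) < K" if "i < ?l" for i
      using ok that unfolding scheme_ok_def set_upt by (meson atLeastLessThan_iff zero_le)
    show "xs ! p < K \<or> (\<exists>a\<in>leaves. xs ! p = K + idx a)" if "p < 2 * ?l" for p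
    proof (rule disjCI)
      assume n: "\<not> (\<exists>a\<in>leaves. xs ! p = K + idx a)"
      show "xs ! p < K"
      proof (rule ccontr)
        assume "\<not> xs ! p < K"
        then have "xs ! p - K < ?s" "xs ! p = K + (xs ! p - K)" using xs[OF that] by auto
        then show False using n idx(3) as(2) by (metis nth_mem subsetD)
      qed
    qed
    fix x y i j
    assume a: "x \<in> pverts G" "y \<in> pverts G" "i < ?l" "j < ?l" "root x = us ! i" "root y = us ! j" "i \<noteq> j"
    have "arc_ok xs ?l i (code x) j (code y) \<or> arc_ok xs ?l j (code y) i (code x)"
      using ok' a(3,4,7) code_in[OF a(1,3,5)] code_in[OF a(2,4,6)] by blast
    then show "arc_good ((!) xs) ?l i (if x \<in> set us then None else Some (K + idx x))
        j (if y \<in> set us then None else Some (K + idx y)) \<or>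
      arc_good ((!) xs) ?l j (if y \<in> set us then None else Some (K + idx y))
        i (if x \<in> set us then None else Some (K + idx x))"
      using tag_good unfolding tag_def by blast
  qed
qed

end

text \<open>The borrowed colors 5 and 6 sit on the two edges at the vertex opposite the root
  (position 3, counted from 0), so each of the two leaves reaches that vertex through the edge
  colored by the other.\<close>

lemma scheme_one_tree: "scheme_ok [0,1,2,3,4,6,0,5,3,4,1,2] 6 5 2 [[5,6,7],[],[],[],[],[]]"
  by code_simp

text \<open>The pattern of \<open>scheme_one_tree\<close>, except that vertex 3 gets a color of its
  own: it now carries a tree and can be internal together with vertex 0.\<close>

lemma scheme_opposite_trees: "scheme_ok [0,1,2,3,4,7,5,6,3,4,1,2] 6 6 2 [[6,7,8],[],[],[8],[],[]]"
  by code_simp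

text \<open>Only the leaf next to one of the opposite trees lends its color, to an edge at the
  vertex opposite its own root.\<close>

lemma scheme_three_trees: "scheme_ok [0,2,1,3,4,0,2,6,1,5,4,3] 6 6 1 [[7],[6,7],[],[7],[],[]]"
  by code_simp

text \<open>The mirror image of the previous word under p \<mapsto> 12 - p, since rotations do not
  supply reflections.\<close>

lemma scheme_three_trees': "scheme_ok [0,3,4,5,1,6,2,0,4,3,1,2] 6 6 1 [[7],[],[],[7],[],[6,7]]"
  by code_simp

text \<open>Each pendant color blocks the half cycle through the root of the other tree, at its last
  edge before the opposite vertex.\<close>

lemma scheme_adjacent_trees: "scheme_ok [0,1,3,4,0,5,2,1,4,6,3,2] 6 5 2 [[5,7],[6,7],[],[],[],[]]"
  by code_simp

text \<open>The word of period 6 with its last color split into the two pendant colors 5 and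
  6.\<close>

lemma scheme_distance_two: "scheme_ok [0,1,2,3,4,5,0,1,2,3,4,6] 6 5 2 [[5,7],[],[6,7],[],[],[]]"
  by code_simp

lemma scheme_seven: "scheme_ok [0,1,2,3,4,5,0,6,4,1,3,2,5,4] 7 6 1 [[6,7],[],[],[],[],[],[]]"
  by code_simp

text \<open>The words fix the places of the trees; rotating \<open>us\<close> moves any vertex to
  position 0.\<close>

lemma unicyclic_rotate:
  assumes "unicyclic G us parent depth"
  shows "unicyclic G (rotate k us) parent depth"
proof -
  interpret unicyclic G us parent depth by (rule assms)
  let ?l = "length us"
  have lpos: "0 < ?l" "us \<noteq> []" using cycle_facts by auto
  have nth: "rotate k us ! i = us ! ((k + i) mod ?l)" if "i < ?l" for i
    using that by (simp add: nth_rotate)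
  have "(rotate k us ! i, rotate k us ! Suc i) \<in> parcs G" if "Suc i < ?l" for i
    using that nth[of i] nth[of "Suc i"] cycle_arc[of "k + i"] by simp
  then have "set (vwalk_arcs (rotate k us)) \<subseteq> parcs G"
    by (auto simp: vwalk_arcs_eq_map)
  then have "vpath (rotate k us) G"
    using cycle_facts by (simp add: vpath_def vwalk_def)
  moreover have "(last (rotate k us), hd (rotate k us)) \<in> parcs G"
  proof -
    have "last (rotate k us) = us ! ((k + (?l - 1)) mod ?l)"
      using lpos nth[of "?l - 1"] by (simp add: last_conv_nth)
    moreover have "hd (rotate k us) = us ! (Suc (k + (?l - 1)) mod ?l)"
    proof -
      have "Suc (k + (?l - 1)) = k + ?l" using lpos by simp
      then have "Suc (k + (?l - 1)) mod ?l = k mod ?l" by (simp only: mod_add_self2)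
      moreover have "hd (rotate k us) = us ! (k mod ?l)" using lpos nth[of 0] by (simp add: hd_conv_nth)
      ultimately show ?thesis by (simp only:)
    qed
    ultimately show ?thesis using cycle_arc[of "k + (?l - 1)"] by simp
  qed
  ultimately have "ucycle G (rotate k us)"
    using cycle_facts by (simp add: ucycle_def)
  moreover have "uedges G = cycle_edges (rotate k us) \<union> (\<lambda>x. {x, parent x}) ` (pverts G - set (rotate k us))"
    using edges cycle_edges_rotate[OF lpos(2)] by simp
  ultimately show ?thesis
    by (intro unicyclic.intro rooted_cycle.intro unicyclic_axioms.intro)
      (use graph parent_arc depth_parent depth_cycle in simp_all)
qed

section \<open>Counting saved colors\<close>

context unicyclic
begin

definition saves :: "nat \<Rightarrow> bool" where
  "saves k \<longleftrightarrow> (\<exists>c. total_rainbow_connected G c \<and> num_colors G c + k \<le> 2 * card (pverts G))"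

lemma card_verts: "card (pverts G) = length us + card (pverts G - set us)"
proof -
  have "card (pverts G) = card (set us) + card (pverts G - set us)"
    using cycle_facts finite_verts by (metis add_diff_cancel_left' card_Diff_subset card_mono finite_set le_add_diff_inverse)
  then show ?thesis using cycle_facts distinct_card by metis
qed

text \<open>The arithmetic rests on n being l plus the number of tree vertices, so 2 n - k absorbs K
  + 2 (n - l) - L.\<close>

lemma savesI:
  assumes "\<exists>c. total_rainbow_connected G c \<and>
      num_colors G c + card leaves \<le> K + 2 * card (pverts G - set us)"
    and "K + k \<le> card leaves + 2 * length us"
  shows "saves k"
proof -
  obtain c where "total_rainbow_connected G c"
    "num_colors G c + card leaves \<le> K + 2 * card (pverts G - set us)"
    using assms(1) by blast
  then show ?thesis
    unfolding saves_def using assms(2) card_verts by (intro exI[of _ c]) auto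
qed

lemma saves_scheme:
  assumes K: "0 < K" and as: "distinct as" "set as \<subseteq> leaves"
    and ok: "scheme_ok xs (length us) K (length as) ys"
    and special: "\<And>k. k < length as \<Longrightarrow>
      \<exists>i<length us. root (as ! k) = us ! ((off + i) mod length us) \<and> K + k \<in> set (ys ! i)"
    and generic: "\<And>x. x \<in> pverts G - set us \<Longrightarrow>
      \<exists>i<length us. root x = us ! ((off + i) mod length us) \<and> K + length as \<in> set (ys ! i)"
    and "K + k \<le> card leaves + 2 * length us"
  shows "saves k"
proof -
  interpret r: unicyclic G "rotate off us" parent depth
    by (rule unicyclic_rotate) (rule unicyclic_axioms)
  have leaves: "r.leaves = leaves" by (simp add: r.leaves_def leaves_def)
  have root: "r.root x = root x" for x by (simp add: r.root_def root_def)
  have nth: "rotate off us ! i = us ! ((off + i) mod length us)" if "i < length us" for i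
    using that by (simp add: nth_rotate)
  have "\<exists>c. total_rainbow_connected G c \<and>
      num_colors G c + card leaves \<le> K + 2 * card (pverts G - set us)"
  proof -
    have "\<exists>i<length (rotate off us). r.root (as ! k) = rotate off us ! i \<and> K + k \<in> set (ys ! i)"
      if "k < length as" for k
      using special[OF that] nth root by auto
    moreover have "\<exists>i<length (rotate off us). r.root x = rotate off us ! i \<and> K + length as \<in> set (ys ! i)"
      if "x \<in> pverts G - set (rotate off us)" for x
      using generic[of x] that nth root by auto
    ultimately show ?thesis
      using r.coloring_scheme[OF K as(1), of xs ys] as(2) ok unfolding leaves by simp
  qed
  then show ?thesis using assms(7) by (rule savesI)
qed

lemma leaves_subset: "leaves \<subseteq> pverts G - set us"
  by (auto simp: leaves_def)

lemma finite_leaves: "finite leaves"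
  using leaves_subset finite_verts by (meson finite_Diff finite_subset)

lemma ex_leaf_same_root:
  assumes "x \<in> pverts G - set us"
  shows "\<exists>a\<in>leaves. root a = root x"
proof -
  obtain a where a: "a \<in> leaves" "x \<in> ancestors a" using ex_leaf_above[OF assms] by blast
  then have "root x = root a" using ancestors_root[of a x] leaves_subset by blast
  then show ?thesis using a(1) by auto
qed

lemma root_index:
  assumes "x \<in> pverts G"
  obtains i where "i < length us" "root x = us ! i"
  using root_in_cycle[OF assms] by (metis in_set_conv_nth)

lemma nth_us_inj: "us ! i = us ! j \<Longrightarrow> i < length us \<Longrightarrow> j < length us \<Longrightarrow> i = j"
  using cycle_facts(3) by (simp add: nth_eq_iff_index_eq)

lemma single_leaf_period:
  assumes "leaves = {a}"
  shows "\<exists>c. total_rainbow_connected G c \<and>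
    num_colors G c + card leaves \<le> length us + 2 * card (pverts G - set us)"
proof (rule coloring_period)
  fix x y i j
  assume x: "x \<in> pverts G - set us" and y: "y \<in> pverts G - set us"
    and ij: "i < length us" "j < length us" and r: "root x = us ! i" "root y = us ! j"
  have "root x = root a" "root y = root a"
    using ex_leaf_same_root[OF x] ex_leaf_same_root[OF y] assms by simp_all
  then have "i = j" using r ij nth_us_inj by simp
  then show "2 * ((j + length us - i) mod length us) \<noteq> length us" using cycle_facts(2) by simp
qed

text \<open>For odd l no two vertices are opposite and K = l does whenever l + L \<ge> 9, leaving
  only l = 7, L = 1. For even l, K = l + 1 does whenever l + L \<ge> 10, leaving only l = 8, L = 1,
  where a single tree allows K = l again.\<close>

lemma saves_long_cycle:
  assumes ne: "leaves \<noteq> {}" and l: "7 \<le> length us"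
  shows "saves 9"
proof -
  have L: "1 \<le> card leaves" using ne finite_leaves by (simp add: Suc_le_eq card_gt_0_iff)
  show ?thesis
  proof (cases "odd (length us)")
    case True
    have period: "\<exists>c. total_rainbow_connected G c \<and>
        num_colors G c + card leaves \<le> length us + 2 * card (pverts G - set us)"
      by (rule coloring_period) (use True in \<open>metis dvd_triv_left\<close>)
    show ?thesis
    proof (cases "length us = 7 \<and> card leaves = 1")
      case False
      then have "length us + 9 \<le> card leaves + 2 * length us"
        using L l True by (cases "length us = 8") auto
      then show ?thesis by (rule savesI[OF period])
    next
      case seven: True
      then obtain a where a: "leaves = {a}" by (metis card_1_singletonE)
      then have "a \<in> pverts G" using leaves_subset by blast
      then obtain off where off: "off < length us" "root a = us ! off" by (rule root_index)
      show ?thesis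
      proof (rule saves_scheme[of 6 "[a]" _ _ off])
        show "scheme_ok [0,1,2,3,4,5,0,6,4,1,3,2,5,4] (length us) 6 (length [a]) [[6,7],[],[],[],[],[],[]]"
          using scheme_seven seven by simp
        show "\<exists>i<length us. root ([a] ! k) = us ! ((off + i) mod length us) \<and>
            6 + k \<in> set ([[6,7],[],[],[],[],[],[]] ! i)" if "k < length [a]" for k
          using that off by (intro exI[of _ 0]) auto
        show "\<exists>i<length us. root x = us ! ((off + i) mod length us) \<and>
            6 + length [a] \<in> set ([[6,7],[],[],[],[],[],[]] ! i)" if "x \<in> pverts G - set us" for x
          using ex_leaf_same_root[OF that] a off by (intro exI[of _ 0]) auto
      qed (use a seven in auto)
    qed
  next
    case False
    then have ev: "even (length us)" by simp
    show ?thesis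
    proof (cases "length us = 8 \<and> card leaves = 1")
      case True
      then obtain a where a: "leaves = {a}" by (metis card_1_singletonE)
      show ?thesis by (rule savesI[OF single_leaf_period[OF a]]) (use True in simp)
    next
      case False
      have "length us \<noteq> 7" "length us \<noteq> 9" using ev by auto
      then have "length us + 1 + 9 \<le> card leaves + 2 * length us" using False L l by auto
      then show ?thesis by (rule savesI[OF coloring_period_Suc[OF ev]])
    qed
  qed
qed

end

section \<open>Cycles of length six\<close>

lemma less_six_cases: "(i::nat) < 6 \<Longrightarrow> i = 0 \<or> i = 1 \<or> i = 2 \<or> i = 3 \<or> i = 4 \<or> i = 5"
  by linarith

lemma hexagon_offset:
  fixes i j d :: nat
  assumes "i < 6" "j < 6" "(j + 6 - i) mod 6 = d"
  shows "j = (i + d) mod 6"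
proof -
  have "(i + (j + 6 - i) mod 6) mod 6 = (i + (j + 6 - i)) mod 6" by (rule mod_add_right_eq)
  also have "\<dots> = j" using assms by simp
  finally show ?thesis using assms(3) by simp
qed

lemma hexagon_pair_cases:
  fixes i j :: nat
  assumes "i < 6" "j < 6"
  shows "(j + 6 - i) mod 6 \<in> {0, 1, 2, 3} \<or> (i + 6 - j) mod 6 \<in> {1, 2}"
  using less_six_cases[OF assms(1)] less_six_cases[OF assms(2)] by (elim disjE) simp_all

lemma hexagon_opposite_sym:
  fixes i j :: nat
  assumes "i < 6" "j < 6" "(j + 6 - i) mod 6 = 3"
  shows "(i + 6 - j) mod 6 = 3"
  using less_six_cases[OF assms(1)] less_six_cases[OF assms(2)] assms(3) by (elim disjE) simp_all

text \<open>Every vertex of a hexagon is equal or adjacent to one of two given opposite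
  vertices.\<close>

lemma hexagon_near_opposite:
  fixes i j r :: nat
  assumes "i < 6" "j < 6" "r < 6" "(j + 6 - i) mod 6 = 3"
  shows "(r + 6 - i) mod 6 \<in> {0, 1, 5} \<or> (r + 6 - j) mod 6 \<in> {0, 1, 5}"
proof -
  have "j = (i + 3) mod 6" using hexagon_offset assms by simp
  then show ?thesis
    using less_six_cases[OF assms(1)] less_six_cases[OF assms(3)] by (elim disjE) simp_all
qed

context unicyclic
begin

text \<open>Only leaves have to be located, because every nontrivial tree contains one;
  \<open>ix\<close> lists the positions of the trees relative to \<open>off\<close>.\<close>

lemma saves_six_leaf_pair:
  assumes l: "length us = 6" and ab: "a \<in> leaves" "b \<in> leaves" "a \<noteq> b"
    and ok: "scheme_ok xs 6 K 2 ys" "0 < K"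
    and a: "root a = us ! ((off + i) mod 6)" "i < 6" "K \<in> set (ys ! i)"
    and b: "root b = us ! ((off + j) mod 6)" "j < 6" "K + 1 \<in> set (ys ! j)"
    and generic: "\<forall>x\<in>leaves. \<exists>i\<in>set ix. root x = us ! ((off + i) mod 6)"
      "\<forall>i\<in>set ix. i < 6 \<and> K + 2 \<in> set (ys ! i)"
    and k: "K + k \<le> card leaves + 12"
  shows "saves k"
proof (rule saves_scheme[of K "[a, b]" xs ys off k])
  show "\<exists>i<length us. root ([a, b] ! q) = us ! ((off + i) mod length us) \<and> K + q \<in> set (ys ! i)"
    if "q < length [a, b]" for q
  proof -
    have "q = 0 \<or> q = 1" using that by auto
    then show ?thesis using a b l by auto
  qed
  show "\<exists>i<length us. root x = us ! ((off + i) mod length us) \<and> K + length [a, b] \<in> set (ys ! i)"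
    if x: "x \<in> pverts G - set us" for x
  proof -
    obtain y where "y \<in> leaves" "root y = root x" using ex_leaf_same_root[OF x] by blast
    then obtain i where "i \<in> set ix" "root x = us ! ((off + i) mod 6)" using generic(1) by auto
    then show ?thesis using generic(2) l by (intro exI[of _ i]) (simp add: numeral_2_eq_2)
  qed
qed (use ab l ok k in \<open>auto simp: numeral_2_eq_2\<close>)

lemma saves_six_leaf:
  assumes l: "length us = 6" and a: "a \<in> leaves"
    and ok: "scheme_ok xs 6 K 1 ys" "0 < K"
    and "root a = us ! ((off + i) mod 6)" "i < 6" "K \<in> set (ys ! i)"
    and generic: "\<forall>x\<in>leaves. \<exists>i\<in>set ix. root x = us ! ((off + i) mod 6)"
      "\<forall>i\<in>set ix. i < 6 \<and> K + 1 \<in> set (ys ! i)"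
    and k: "K + k \<le> card leaves + 12"
  shows "saves k"
proof (rule saves_scheme[of K "[a]" xs ys off k])
  show "\<exists>i<length us. root ([a] ! q) = us ! ((off + i) mod length us) \<and> K + q \<in> set (ys ! i)"
    if "q < length [a]" for q
    using that assms(5-7) l by auto
  show "\<exists>i<length us. root x = us ! ((off + i) mod length us) \<and> K + length [a] \<in> set (ys ! i)"
    if x: "x \<in> pverts G - set us" for x
  proof -
    obtain y where "y \<in> leaves" "root y = root x" using ex_leaf_same_root[OF x] by blast
    then obtain i where "i \<in> set ix" "root x = us ! ((off + i) mod 6)" using generic(1) by auto
    then show ?thesis using generic(2) l by (intro exI[of _ i]) simp
  qed
qed (use a l ok k in auto)

text \<open>Five cycle colors are just enough: 5 + 9 = 2 + 12. Offsets 4 and 5 become 2 and 1 after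
  exchanging the two leaves.\<close>

lemma saves_six_two_leaves:
  assumes l: "length us = 6" and L: "leaves = {a, b}" "a \<noteq> b"
    and i: "i < 6" "root a = us ! i" and j: "j < 6" "root b = us ! j"
    and nopp: "(j + 6 - i) mod 6 \<noteq> 3"
  shows "saves 9"
proof -
  have card: "card leaves = 2" using L by simp
  have ra: "root a = us ! ((i + 0) mod 6)" and rb: "root b = us ! ((j + 0) mod 6)" using i j by auto
  consider "(j + 6 - i) mod 6 = 0" | "(j + 6 - i) mod 6 = 1" | "(j + 6 - i) mod 6 = 2"
    | "(i + 6 - j) mod 6 = 1" | "(i + 6 - j) mod 6 = 2"
    using nopp hexagon_pair_cases[OF i(1) j(1)] by auto
  then show ?thesis
  proof cases
    case 1
    then have "j = i" using hexagon_offset[OF i(1) j(1)] i(1) by simp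
    then have rb: "root b = us ! ((i + 0) mod 6)" using rb by simp
    show ?thesis
      by (rule saves_six_leaf_pair[where ix = "[0]", OF l _ _ L(2) scheme_one_tree _ ra _ _ rb])
        (use L card ra rb in auto)
  next
    case 2
    then have "j = (i + 1) mod 6" by (rule hexagon_offset[OF i(1) j(1)])
    then have rb: "root b = us ! ((i + 1) mod 6)" using j by simp
    show ?thesis
      by (rule saves_six_leaf_pair[where ix = "[0, 1]", OF l _ _ L(2) scheme_adjacent_trees _ ra _ _ rb])
        (use L card ra rb in auto)
  next
    case 3
    then have "j = (i + 2) mod 6" by (rule hexagon_offset[OF i(1) j(1)])
    then have rb: "root b = us ! ((i + 2) mod 6)" using j by simp
    show ?thesis
      by (rule saves_six_leaf_pair[where ix = "[0, 2]", OF l _ _ L(2) scheme_distance_two _ ra _ _ rb])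
        (use L card ra rb in auto)
  next
    case 4
    then have "i = (j + 1) mod 6" by (rule hexagon_offset[OF j(1) i(1)])
    then have ra: "root a = us ! ((j + 1) mod 6)" using i by simp
    show ?thesis
      by (rule saves_six_leaf_pair[where ix = "[0, 1]", OF l _ _ L(2)[symmetric] scheme_adjacent_trees _ rb _ _ ra])
        (use L card ra rb in auto)
  next
    case 5
    then have "i = (j + 2) mod 6" by (rule hexagon_offset[OF j(1) i(1)])
    then have ra: "root a = us ! ((j + 2) mod 6)" using i by simp
    show ?thesis
      by (rule saves_six_leaf_pair[where ix = "[0, 2]", OF l _ _ L(2)[symmetric] scheme_distance_two _ rb _ _ ra])
        (use L card ra rb in auto)
  qed
qed

text \<open>The budget is K = 6. The leaf \<open>c\<close> lends its pendant color, joined by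
  \<open>a\<close> when both hang in the same tree.\<close>

lemma saves_six_three_leaves_opposite:
  assumes l: "length us = 6" and L: "leaves = {a, b, c}" "card leaves = 3"
    and i: "i < 6" "root a = us ! i" and j: "j < 6" "root b = us ! j"
    and opp: "(j + 6 - i) mod 6 = 3" and r: "r < 6" "root c = us ! r"
    and near: "(r + 6 - i) mod 6 \<in> {0, 1, 5}"
  shows "saves 9"
proof -
  have ne: "a \<noteq> c"
  proof
    assume "a = c"
    then have "card leaves \<le> 2" using L(1) card_insert_le_m1[of 2 "{b}" c] by (simp add: insert_commute)
    then show False using L(2) by simp
  qed
  have ra: "root a = us ! ((i + 0) mod 6)" using i by auto
  have "j = (i + 3) mod 6" by (rule hexagon_offset[OF i(1) j(1) opp])
  then have rb: "root b = us ! ((i + 3) mod 6)" using j by simp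
  consider "(r + 6 - i) mod 6 = 0" | "(r + 6 - i) mod 6 = 1" | "(r + 6 - i) mod 6 = 5"
    using near by auto
  then show ?thesis
  proof cases
    case 1
    then have "r = i" using hexagon_offset[OF i(1) r(1)] i(1) by simp
    then have rc: "root c = us ! ((i + 0) mod 6)" using r by simp
    show ?thesis
      by (rule saves_six_leaf_pair[where ix = "[0, 3]", OF l _ _ ne scheme_opposite_trees _ ra _ _ rc])
        (use L ra rb rc in auto)
  next
    case 2
    then have "r = (i + 1) mod 6" by (rule hexagon_offset[OF i(1) r(1)])
    then have rc: "root c = us ! ((i + 1) mod 6)" using r by simp
    show ?thesis
      by (rule saves_six_leaf[where ix = "[0, 1, 3]", OF l _ scheme_three_trees _ rc])
        (use L ra rb rc in auto)
  next
    case 3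
    then have "r = (i + 5) mod 6" by (rule hexagon_offset[OF i(1) r(1)])
    then have rc: "root c = us ! ((i + 5) mod 6)" using r by simp
    show ?thesis
      by (rule saves_six_leaf[where ix = "[0, 3, 5]", OF l _ scheme_three_trees' _ rc])
        (use L ra rb rc in auto)
  qed
qed

text \<open>Without opposite trees the word of period 6 meets the budget. Otherwise the third leaf
  is near one of the opposite roots, and by symmetry that one may be taken as the first.\<close>

lemma saves_six_three_leaves:
  assumes l: "length us = 6" and L: "card leaves = 3"
  shows "saves 9"
proof (cases "\<exists>x y i j. x \<in> pverts G - set us \<and> y \<in> pverts G - set us \<and> i < 6 \<and> j < 6 \<and>
    root x = us ! i \<and> root y = us ! j \<and> 2 * ((j + 6 - i) mod 6) = (6::nat)")
  case False
  have "\<exists>c. total_rainbow_connected G c \<and>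
      num_colors G c + card leaves \<le> length us + 2 * card (pverts G - set us)"
    by (rule coloring_period) (use False l in metis)
  then show ?thesis by (rule savesI) (use l L in simp)
next
  case True
  then obtain x y i j where xy: "x \<in> pverts G - set us" "y \<in> pverts G - set us"
    and ij: "i < 6" "j < 6" and r: "root x = us ! i" "root y = us ! j"
    and "2 * ((j + 6 - i) mod 6) = (6::nat)" by blast
  then have opp: "(j + 6 - i) mod 6 = 3" by simp
  obtain a where a: "a \<in> leaves" "root a = us ! i" using ex_leaf_same_root[OF xy(1)] r by auto
  obtain b where b: "b \<in> leaves" "root b = us ! j" using ex_leaf_same_root[OF xy(2)] r by auto
  have "i \<noteq> j" using opp by auto
  then have "a \<noteq> b" using a b nth_us_inj[of i j] ij l by auto
  then have "card (leaves - {a, b}) = 1" using L a b finite_leaves by (simp add: card_Diff_subset)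
  then obtain c where c: "leaves - {a, b} = {c}" by (metis card_1_singletonE)
  then have leaves: "leaves = {a, b, c}" "leaves = {b, a, c}" using a b by blast+
  then have "c \<in> pverts G" using leaves_subset by blast
  then obtain r where r: "r < 6" "root c = us ! r" using root_index l by metis
  have opp': "(i + 6 - j) mod 6 = 3" using hexagon_opposite_sym[OF ij opp] .
  consider "(r + 6 - i) mod 6 \<in> {0, 1, 5}" | "(r + 6 - j) mod 6 \<in> {0, 1, 5}"
    using hexagon_near_opposite[OF ij r(1) opp] by blast
  then show ?thesis
  proof cases
    case 1
    then show ?thesis
      by (rule saves_six_three_leaves_opposite[OF l leaves(1) L ij(1) a(2) ij(2) b(2) opp r])
  next
    case 2
    then show ?thesis
      by (rule saves_six_three_leaves_opposite[OF l leaves(2) L ij(2) b(2) ij(1) a(2) opp' r])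
  qed
qed

lemma saves_six:
  assumes l: "length us = 6" and ne: "leaves \<noteq> {}"
  shows "saves 7"
proof -
  have L: "1 \<le> card leaves" using ne finite_leaves by (simp add: Suc_le_eq card_gt_0_iff)
  show ?thesis
  proof (cases "card leaves = 1")
    case True
    then obtain a where a: "leaves = {a}" by (metis card_1_singletonE)
    show ?thesis by (rule savesI[OF single_leaf_period[OF a]]) (use True l in simp)
  next
    case False
    show ?thesis by (rule savesI[OF coloring_period_Suc]) (use False L l in auto)
  qed
qed

lemma six_cases:
  assumes l: "length us = 6" and ne: "leaves \<noteq> {}" and not9: "\<not> saves 9"
  obtains (one) a where "leaves = {a}"
  | (two) a b i where "leaves = {a, b}" "a \<noteq> b" "i < 6" "root a = us ! i" "root b = us ! ((i + 3) mod 6)"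
proof -
  have L: "1 \<le> card leaves" using ne finite_leaves by (simp add: Suc_le_eq card_gt_0_iff)
  have "\<not> 4 \<le> card leaves"
  proof
    assume "4 \<le> card leaves"
    then have "saves 9" using l by (intro savesI[OF coloring_period_Suc]) auto
    then show False using not9 by blast
  qed
  moreover have "card leaves \<noteq> 3" using saves_six_three_leaves[OF l] not9 by blast
  ultimately consider "card leaves = 1" | "card leaves = 2" using L by linarith
  then show thesis
  proof cases
    case 1
    then show ?thesis using one by (metis card_1_singletonE)
  next
    case 2
    then obtain a b where ab: "leaves = {a, b}" "a \<noteq> b" by (auto simp: card_2_iff)
    then have V: "a \<in> pverts G" "b \<in> pverts G" using leaves_subset by blast+
    obtain i where i: "i < 6" "root a = us ! i" using root_index[OF V(1)] l by metis
    obtain j where j: "j < 6" "root b = us ! j" using root_index[OF V(2)] l by metis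
    have "(j + 6 - i) mod 6 = 3" using saves_six_two_leaves[OF l ab i j] not9 by blast
    then have "j = (i + 3) mod 6" by (rule hexagon_offset[OF i(1) j(1)])
    then show ?thesis using two[OF ab i] j by simp
  qed
qed

end

section \<open>The extremal graphs\<close>

definition hexagon_dist :: "nat \<Rightarrow> nat \<Rightarrow> nat" where
  "hexagon_dist i k = min ((k + 6 - i) mod 6) (6 - (k + 6 - i) mod 6)"

lemma hexagon_dist_Suc:
  assumes "i < 6" "k < 6"
  shows "hexagon_dist i (Suc k mod 6) \<le> hexagon_dist i k + 1 \<and> hexagon_dist i k \<le> hexagon_dist i (Suc k mod 6) + 1"
  unfolding hexagon_dist_def
  using less_six_cases[OF assms(1)] less_six_cases[OF assms(2)] by (elim disjE) simp_all

lemma hexagon_dist_opposite: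
  assumes "i < 6"
  shows "hexagon_dist i ((i + 3) mod 6) = 3"
  unfolding hexagon_dist_def using less_six_cases[OF assms] by (elim disjE) simp_all

context unicyclic
begin

text \<open>The potential counts depth negatively in the tree of \<open>x\<close> and adds it to the
  hexagon distance elsewhere. It climbs from minus the depth of \<open>x\<close> to 3 plus the depth
  of \<open>y\<close>, at most one per edge.\<close>

lemma opposite_distance:
  assumes l: "length us = 6" and V: "x \<in> pverts G" "y \<in> pverts G" and i: "i < 6"
    and rx: "root x = us ! i" and ry: "root y = us ! ((i + 3) mod 6)"
    and p: "vpath p G" "hd p = x" "last p = y"
  shows "depth x + depth y + 3 \<le> vwalk_length p"
proof -
  obtain pos :: "'a \<Rightarrow> nat" where pos: "\<And>k. k < length us \<Longrightarrow> pos (us ! k) = k"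
    by (rule ex_index[of "set us" us]) (use cycle_facts in auto)
  \<comment> \<open>a potential that changes by at most one along every edge\<close>
  define h where "h v = (if root v = us ! i then - int (depth v)
    else int (hexagon_dist i (pos (root v))) + int (depth v))" for v
  have cyc: "h (us ! k) = int (hexagon_dist i k)" if "k < 6" for k
  proof -
    have "us ! k \<in> set us" using that l by simp
    moreover have "hexagon_dist i i = 0" by (simp add: hexagon_dist_def)
    ultimately show ?thesis
      using pos[of k] that l i nth_us_inj[of k i] by (auto simp: h_def depth_cycle)
  qed
  have lip: "h w \<le> h v + 1" if "(v, w) \<in> parcs G" for v w
  proof -
    have "{v, w} \<in> cycle_edges us \<or> {v, w} \<in> (\<lambda>x. {x, parent x}) ` (pverts G - set us)"
      using that uedge_iff[OF graph, of v w] unfolding edges by simp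
    then show ?thesis
    proof
      assume "{v, w} \<in> cycle_edges us"
      then obtain k where k: "k < 6" "{v, w} = {us ! k, us ! (Suc k mod 6)}"
        using cycle_edges_eq[OF cycle_facts(2)] l by auto
      have "h (us ! k) = int (hexagon_dist i k)" "h (us ! (Suc k mod 6)) = int (hexagon_dist i (Suc k mod 6))"
        using cyc[OF k(1)] cyc[of "Suc k mod 6"] by simp_all
      then have "h (us ! k) \<le> h (us ! (Suc k mod 6)) + 1" "h (us ! (Suc k mod 6)) \<le> h (us ! k) + 1"
        using hexagon_dist_Suc[OF i k(1)] by linarith+
      then show ?thesis using k(2) by (auto simp: doubleton_eq_iff)
    next
      assume "{v, w} \<in> (\<lambda>x. {x, parent x}) ` (pverts G - set us)"
      then obtain z where z: "z \<in> pverts G - set us" "{v, w} = {z, parent z}" by blast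
      have "h z \<le> h (parent z) + 1" "h (parent z) \<le> h z + 1"
        using depth_parent[OF z(1)] root_parent[OF z(1)] by (simp_all add: h_def)
      then show ?thesis using z(2) by (auto simp: doubleton_eq_iff)
    qed
  qed
  have "(i + 3) mod 6 \<noteq> i" using i less_six_cases[OF i] by (elim disjE) simp_all
  then have "root y \<noteq> us ! i" using ry nth_us_inj[of "(i + 3) mod 6" i] l i by auto
  then have "h y = 3 + int (depth y)"
    using ry pos[of "(i + 3) mod 6"] l hexagon_dist_opposite[OF i] by (simp add: h_def)
  moreover have "h x = - int (depth x)" using rx by (simp add: h_def)
  moreover have "h y - h x \<le> int (vwalk_length p)" using vpath_potential[OF p(1), of h] lip p(2,3) by simp
  ultimately show ?thesis by linarith
qed

lemma funpow_parent:
  assumes "x \<in> pverts G" "k \<le> depth x"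
  shows "(parent ^^ k) x \<in> pverts G \<and> depth ((parent ^^ k) x) = depth x - k"
  using assms(2)
proof (induct k)
  case (Suc k)
  then have "(parent ^^ k) x \<in> pverts G - set us" "depth ((parent ^^ k) x) = depth x - k"
    using depth_cycle[of "(parent ^^ k) x"] by auto
  then show ?case using depth_parent[of "(parent ^^ k) x"] parent_in_verts Suc.prems by auto
qed (use assms in simp)

text \<open>Every tree vertex is an ancestor of some leaf, here of \<open>a\<close>, so the trees
  reduce to the chain of ancestors of \<open>a\<close>.\<close>

lemma single_leaf_in_B6:
  assumes l: "length us = 6" and L: "leaves = {a}"
  shows "G \<in> B6 (card (pverts G))"
proof -
  define d where "d = depth a"
  \<comment> \<open>Listed from the root outwards, so that \<open>p ! k\<close> has depth k and the
    list starts on the cycle.\<close>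
  define p where "p = map (\<lambda>k. (parent ^^ (d - k)) a) [0..<Suc d]"
  have aT: "a \<in> pverts G - set us" using L leaves_subset by blast
  then have d0: "0 < d" using depth_parent by (simp add: d_def)
  have aV: "a \<in> pverts G" using aT by simp
  obtain i where "i < length us" and ri: "root a = us ! i" by (rule root_index[OF aV])
  then have i: "i < 6" "root a = us ! i" using l by simp_all
  define vs where "vs = rotate i us"
  have vs: "length vs = 6" "distinct vs" "set vs = set us" "hd vs = us ! i"
    using l cycle_facts i by (auto simp: vs_def hd_rotate_conv_nth)
  have anc: "ancestors a = (\<lambda>k. (parent ^^ k) a) ` {..d}" by (auto simp: ancestors_def d_def)
  have len: "length p = Suc d" by (simp add: p_def)
  have nth: "p ! k = (parent ^^ (d - k)) a" if "k \<le> d" for k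
    using that by (simp add: p_def del: upt_Suc)
  have dep: "depth (p ! k) = k" "p ! k \<in> pverts G" if "k \<le> d" for k
    using that nth[OF that] funpow_parent[of a "d - k"] aT by (simp_all add: d_def)
  have dist: "distinct p"
    unfolding distinct_conv_nth
  proof (intro allI impI notI)
    fix q r assume "q < length p" "r < length p" "q \<noteq> r" "p ! q = p ! r"
    then show False using dep(1)[of q] dep(1)[of r] len by simp
  qed
  have set_p: "set p = ancestors a"
  proof -
    have "set p = (\<lambda>k. (parent ^^ (d - k)) a) ` {..d}"
      by (simp add: p_def atLeast0LessThan lessThan_Suc_atMost del: upt_Suc)
    also have "\<dots> = (\<lambda>k. (parent ^^ k) a) ` (\<lambda>k. d - k) ` {..d}" by (simp add: image_image)
    also have "(\<lambda>k. d - k) ` {..d} = {..d}"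
    proof (intro equalityI subsetI)
      fix k assume "k \<in> {..d}"
      then show "k \<in> (\<lambda>k. d - k) ` {..d}" by (intro image_eqI[of _ _ "d - k"]) auto
    qed auto
    finally show ?thesis using anc by simp
  qed
  have "p \<noteq> []" using len by auto
  then have hd: "hd p = root a" using nth[of 0] hd_conv_nth[of p] by (simp add: root_def d_def)
  have T_anc: "pverts G - set us = ancestors a - set us"
  proof (intro equalityI subsetI)
    fix x assume x: "x \<in> pverts G - set us"
    then show "x \<in> ancestors a - set us" using ex_leaf_above[OF x] L by simp
  qed (use ancestors_in_verts[of a] aT in blast)
  have c1: "set vs \<inter> set p = {hd vs}"
    unfolding vs(3)
    unfolding set_p vs(4) ri[symmetric]
    using ancestors_Int_cycle[OF aV] root_in_ancestors[OF aV] root_in_cycle[OF aV] by blast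
  have c2: "pverts G = set vs \<union> set p"
    unfolding vs(3) using T_anc set_p ancestors_in_verts[of a] aT cycle_facts by blast
  have c3: "(\<lambda>x. {x, parent x}) ` (pverts G - set us) = set (path_edges p)"
  proof -
    have nthT: "p ! Suc k \<in> pverts G - set us" "parent (p ! Suc k) = p ! k" if "k < d" for k
    proof -
      show "p ! Suc k \<in> pverts G - set us" using dep[of "Suc k"] depth_cycle[of "p ! Suc k"] that by auto
      have "d - k = Suc (d - Suc k)" using that by simp
      then show "parent (p ! Suc k) = p ! k" using nth[of k] nth[of "Suc k"] that by simp
    qed
    have "pverts G - set us = (\<lambda>k. p ! Suc k) ` {0..<d}"
    proof (intro equalityI subsetI)
      fix x assume x: "x \<in> pverts G - set us"
      then have "x \<in> set p" using T_anc set_p by blast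
      then obtain k where k: "k \<le> d" "x = p ! k" using len by (metis in_set_conv_nth less_Suc_eq_le)
      then have "k \<noteq> 0" using dep(1)[of k] depth_parent[OF x] by auto
      then obtain q where "k = Suc q" by (cases k) auto
      then show "x \<in> (\<lambda>k. p ! Suc k) ` {0..<d}" using k by auto
    qed (use nthT in auto)
    then have "(\<lambda>x. {x, parent x}) ` (pverts G - set us) = (\<lambda>k. {p ! Suc k, parent (p ! Suc k)}) ` {0..<d}"
      by (simp add: image_image)
    also have "\<dots> = (\<lambda>k. {p ! k, p ! Suc k}) ` {0..<d}"
      using nthT by (intro image_cong) auto
    finally show ?thesis by (simp add: path_edges_eq_map len)
  qed
  have c4: "cycle_edges vs = cycle_edges us"
    unfolding vs_def by (rule cycle_edges_rotate) (use cycle_facts in simp)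
  have c5: "uedges G = cycle_edges vs \<union> set (path_edges p)" unfolding edges c3 c4 ..
  have c6: "2 \<le> length p" "hd p = hd vs" using len d0 hd i(2) vs(4) by simp_all
  show ?thesis
    unfolding B6_def mem_Collect_eq
    by (intro conjI exI[of _ vs] exI[of _ p]) (fact graph refl vs c1 c2 c5 c6 dist)+
qed

text \<open>The upper bound on the diameter is read off from the number of colors of a coloring.\<close>

lemma gdist_le_if_saves:
  assumes "saves 7" "u \<in> pverts G" "v \<in> pverts G"
  shows "gdist G u v + 3 \<le> card (pverts G)"
proof (cases "u = v")
  case True
  have "vpath [u] (with_proj G)" using assms by (auto simp: vpath_def vwalk_def)
  then have "gdist G u v \<le> 0" using gdist_le[of "[u]" G] True by simp
  then show ?thesis using card_verts cycle_facts(1) by simp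
next
  case False
  obtain c where c: "total_rainbow_connected G c" "num_colors G c + 7 \<le> 2 * card (pverts G)"
    using assms(1) unfolding saves_def by blast
  have "2 * gdist G u v \<le> num_colors G c + 1"
    by (rule num_colors_ge[OF graph c(1) assms(2,3) False]) (use gdist_le in blast)
  then show ?thesis using c(2) by linarith
qed

text \<open>\<open>gdist\<close> is a LEAST, meaningful only if a path exists; the coloring behind
  \<open>saves k\<close> provides one.\<close>

lemma gdist_ge:
  assumes "saves k" "u \<in> pverts G" "v \<in> pverts G" "u \<noteq> v"
    and "\<And>p. vpath p G \<Longrightarrow> hd p = u \<Longrightarrow> last p = v \<Longrightarrow> D \<le> vwalk_length p"
  shows "D \<le> gdist G u v"
proof -
  obtain c where "total_rainbow_connected G c" using assms(1) unfolding saves_def by blast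
  then obtain p where p: "vpath p (with_proj G)" "hd p = u" "last p = v"
    using assms(2-4) unfolding total_rainbow_connected_def by blast
  obtain q where "vpath q (with_proj G)" "hd q = u" "last q = v" "vwalk_length q = gdist G u v"
    using gdist_attained[OF p(1)] p(2,3) by auto
  then show ?thesis using assms(5) by metis
qed

text \<open>The surviving edges are parent edges, and these preserve the root, so the component of
  \<open>u\<close> is the fiber of \<open>root\<close> over \<open>u\<close>.\<close>

lemma hanging_tree_verts:
  assumes "u \<in> set us"
  shows "verts (hanging_tree G us u) = {v \<in> pverts G. root v = u}"
    and "arcs (hanging_tree G us u) =
      {(v, w) \<in> parcs G. {v, w} \<notin> cycle_edges us \<and> root v = u \<and> root w = u}"
proof -
  let ?H = "with_proj (del_cycle_edges G us)"
  have H: "verts ?H = pverts G" "arcs_ends ?H = {(v, w) \<in> parcs G. {v, w} \<notin> cycle_edges us}"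
    "arcs ?H = {(v, w) \<in> parcs G. {v, w} \<notin> cycle_edges us}" "tail ?H = fst" "head ?H = snd"
    by (auto simp: del_cycle_edges_def edge_of_def)
  have arc_root: "root v = root w" if "(v, w) \<in> parcs G" "{v, w} \<notin> cycle_edges us" for v w
  proof -
    have "{v, w} \<in> (\<lambda>x. {x, parent x}) ` (pverts G - set us)"
      using that uedge_iff[OF graph, of v w] unfolding edges by simp
    then obtain z where "z \<in> pverts G - set us" "{v, w} = {z, parent z}" by blast
    then show ?thesis using root_parent[of z] by (auto simp: doubleton_eq_iff)
  qed
  have reach1: "v \<in> pverts G \<and> root v = u" if "u \<rightarrow>\<^sup>*\<^bsub>?H\<^esub> v" for v
    using that unfolding reachable_def H
  proof (induct rule: rtrancl_on_induct)
    case (step v w)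
    then show ?case using arc_root[of v w] by auto
  qed (use assms in auto)
  have reach2: "root v \<rightarrow>\<^sup>*\<^bsub>?H\<^esub> v" if "v \<in> pverts G" for v
    using that
  proof (induct v rule: tree_induct)
    case (cycle v)
    then show ?case unfolding reachable_def H(1) using cycle_facts(4) by auto
  next
    case (tree v)
    have "{parent v, v} \<notin> cycle_edges us"
      using tree(1) Union_cycle_edges[OF cycle_facts(2)] by blast
    then have "(parent v, v) \<in> arcs_ends ?H" using arcs_sym[OF parent_arc[OF tree(1)]] H(2) by auto
    then have "root (parent v) \<rightarrow>\<^sup>*\<^bsub>?H\<^esub> v"
      using tree unfolding reachable_def H(1) by (auto intro: rtrancl_on_into_rtrancl_on)
    then show ?case using root_parent[OF tree(1)] by simp
  qed
  have set_eq: "{v. u \<rightarrow>\<^sup>*\<^bsub>?H\<^esub> v} = {v \<in> pverts G. root v = u}"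
    using reach1 reach2 by blast
  show "verts (hanging_tree G us u) = {v \<in> pverts G. root v = u}"
    by (simp add: hanging_tree_def set_eq)
  show "arcs (hanging_tree G us u) =
      {(v, w) \<in> parcs G. {v, w} \<notin> cycle_edges us \<and> root v = u \<and> root w = u}"
    unfolding hanging_tree_def Let_def set_eq induce_subgraph_arcs H using arcs_verts by auto
qed

lemma nontrivial_hanging_tree_iff:
  assumes "u \<in> set us"
  shows "nontrivial (hanging_tree G us u) \<longleftrightarrow> (\<exists>x\<in>pverts G - set us. root x = u)"
proof
  assume "nontrivial (hanging_tree G us u)"
  then obtain v w where vw: "(v, w) \<in> parcs G" "{v, w} \<notin> cycle_edges us" "root v = u" "root w = u"
    unfolding nontrivial_def hanging_tree_verts(2)[OF assms] by blast
  then have "{v, w} \<in> (\<lambda>x. {x, parent x}) ` (pverts G - set us)"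
    using uedge_iff[OF graph, of v w] unfolding edges by simp
  then obtain z where "z \<in> pverts G - set us" "{v, w} = {z, parent z}" by blast
  then show "\<exists>x\<in>pverts G - set us. root x = u" using vw(3,4) by (metis doubleton_eq_iff)
next
  assume "\<exists>x\<in>pverts G - set us. root x = u"
  then obtain x where x: "x \<in> pverts G - set us" "root x = u" by blast
  have "{x, parent x} \<notin> cycle_edges us"
    using x(1) Union_cycle_edges[OF cycle_facts(2)] by blast
  then have "(x, parent x) \<in> arcs (hanging_tree G us u)"
    unfolding hanging_tree_verts(2)[OF assms] using x parent_arc root_parent by simp
  then show "nontrivial (hanging_tree G us u)" unfolding nontrivial_def by blast
qed

text \<open>The hanging trees form a set of graphs, so counting them by their roots requires that
  different roots give different trees.\<close>

lemma inj_on_hanging_tree: "inj_on (hanging_tree G us) (set us)"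
proof (rule inj_onI)
  fix u v assume uv: "u \<in> set us" "v \<in> set us" and "hanging_tree G us u = hanging_tree G us v"
  then have "{x \<in> pverts G. root x = u} = {x \<in> pverts G. root x = v}"
    using hanging_tree_verts(1) by metis
  moreover have "u \<in> {x \<in> pverts G. root x = u}" using uv cycle_facts(4) by auto
  ultimately show "u = v" using uv by auto
qed

text \<open>The disjoint chains above the two roots give n = 6 + \<open>depth a\<close> +
  \<open>depth b\<close>, so the leaves are at distance at least n - 3, while the coloring with 2 n
  - 7 colors keeps every pair within n - 3.\<close>

lemma opposite_leaves_in_J1:
  assumes cu: "connected_unicyclic G" and l: "length us = 6" and L: "leaves = {a, b}" "a \<noteq> b"
    and i: "i < 6" and ra: "root a = us ! i" and rb: "root b = us ! ((i + 3) mod 6)"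
  shows "G \<in> J1 (card (pverts G))"
proof -
  let ?T = "pverts G - set us"
  have aT: "a \<in> ?T" and bT: "b \<in> ?T" using L leaves_subset by blast+
  have "(i + 3) mod 6 \<noteq> i" using i less_six_cases[OF i] by (elim disjE) simp_all
  then have rne: "root a \<noteq> root b" using ra rb nth_us_inj[of "(i + 3) mod 6" i] l i by auto
  have s7: "saves 7" using saves_six[OF l] L by simp
  have "{T \<in> hanging_trees G us. nontrivial T} = hanging_tree G us ` {root a, root b}"
  proof -
    have "(\<exists>x\<in>?T. root x = u) \<longleftrightarrow> u \<in> {root a, root b}" for u
    proof
      assume "\<exists>x\<in>?T. root x = u"
      then obtain x where x: "x \<in> ?T" "root x = u" by blast
      then show "u \<in> {root a, root b}" using ex_leaf_same_root[OF x(1)] L by auto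
    qed (use aT bT in auto)
    then have "{u \<in> set us. nontrivial (hanging_tree G us u)} = {root a, root b}"
      using nontrivial_hanging_tree_iff root_in_cycle aT bT by auto
    then show ?thesis unfolding hanging_trees_def by blast
  qed
  moreover have "card (hanging_tree G us ` {root a, root b}) = card {root a, root b}"
    by (rule card_image, rule inj_on_subset[OF inj_on_hanging_tree]) (use root_in_cycle aT bT in auto)
  ultimately have nontriv: "card {T \<in> hanging_trees G us. nontrivial T} = 2" using rne by simp
  have "card ?T = depth a + depth b"
  proof -
    have "?T = (ancestors a - set us) \<union> (ancestors b - set us)"
    proof (intro equalityI subsetI)
      fix x assume x: "x \<in> ?T"
      then show "x \<in> (ancestors a - set us) \<union> (ancestors b - set us)" using ex_leaf_above[OF x] L by auto
    qed (use ancestors_in_verts[of a] ancestors_in_verts[of b] aT bT in blast)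
    moreover have "(ancestors a - set us) \<inter> (ancestors b - set us) = {}"
      using ancestors_root[of a] ancestors_root[of b] aT bT rne by fastforce
    moreover have "finite (ancestors a)" "finite (ancestors b)"
      using finite_verts ancestors_in_verts[of a] ancestors_in_verts[of b] aT bT
      by (auto intro: finite_subset)
    ultimately have "card ?T = card (ancestors a - set us) + card (ancestors b - set us)"
      by (simp add: card_Un_disjoint)
    then show ?thesis using ancestors_depth[of a] ancestors_depth[of b] aT bT by simp
  qed
  then have n: "card (pverts G) = 6 + depth a + depth b" using card_verts l by simp
  have "depth a + depth b + 3 \<le> gdist G a b"
    by (rule gdist_ge[OF s7 _ _ L(2)]) (use opposite_distance[OF l _ _ i ra rb] aT bT in auto)
  moreover have "gdist G a b + 3 \<le> card (pverts G)" using gdist_le_if_saves[OF s7] aT bT by blast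
  ultimately have gab: "gdist G a b + 3 = card (pverts G)" using n by linarith
  let ?S = "{gdist G u v | u v. u \<in> pverts G \<and> v \<in> pverts G}"
  have "?S = (\<lambda>(u, v). gdist G u v) ` (pverts G \<times> pverts G)" by auto
  then have "finite ?S" using finite_verts by simp
  then have "diam G = gdist G a b"
    unfolding diam_def
  proof (rule Max_eqI)
    show "x \<le> gdist G a b" if "x \<in> ?S" for x
      using that gdist_le_if_saves[OF s7] gab by fastforce
    show "gdist G a b \<in> ?S" using aT bT by blast
  qed
  then have "int (diam G) = int (card (pverts G)) - 3" using gab by simp
  then show ?thesis using cu cyc l nontriv unfolding J1_def by blast
qed

end

section \<open>Vertices at distance n - 3 in the exceptional graphs\<close>

lemma ucycle_if_edges:
  fixes G :: "'a pair_pre_digraph"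
  assumes "pair_graph G" "3 \<le> length us" "distinct us" "set us \<subseteq> pverts G" "cycle_edges us \<subseteq> uedges G"
  shows "ucycle G us"
proof -
  have "us \<noteq> []" using assms(2) by auto
  have "(us ! i, us ! Suc i) \<in> parcs G" if "Suc i < length us" for i
  proof -
    have "{us ! i, us ! Suc i} \<in> set (path_edges us)" using that by (auto simp: path_edges_eq_map)
    then show ?thesis using assms(5) uedge_iff[OF assms(1)] by (auto simp: cycle_edges_def)
  qed
  then have "set (vwalk_arcs us) \<subseteq> parcs G" by (auto simp: vwalk_arcs_eq_map)
  moreover have "(last us, hd us) \<in> parcs G"
    using assms(5) uedge_iff[OF assms(1)] by (auto simp: cycle_edges_def)
  ultimately show ?thesis
    using assms(2-4) \<open>us \<noteq> []\<close> by (simp add: ucycle_def vpath_def vwalk_def)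
qed

lemma unique_cycle_length:
  assumes "connected_unicyclic G" "ucycle G us" "ucycle G vs"
  shows "length us = length vs"
proof -
  have "us \<noteq> []" "vs \<noteq> []" "distinct us" "distinct vs"
    using assms(2,3) by (auto simp: ucycle_def vpath_def)
  then have "set us = set vs" using unique_cycle_edges[OF assms] Union_cycle_edges by metis
  then show ?thesis using \<open>distinct us\<close> \<open>distinct vs\<close> distinct_card by metis
qed

text \<open>Along the attached path the parent is the predecessor and the depth is the index; the
  explicit edge set yields the rooted structure directly.\<close>

lemma B6_structure:
  assumes "G \<in> B6 n"
  obtains us parent depth a where "unicyclic G us parent depth" "length us = 6" "a \<in> pverts G"
    "rooted_cycle.root parent depth a = us ! 0" "n = 6 + depth a" "0 < depth a"
proof -
  obtain us p where pg: "pair_graph G" and n: "card (pverts G) = n"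
    and us: "length us = 6" "distinct us"
    and p: "2 \<le> length p" "distinct p" "hd p = hd us" "set us \<inter> set p = {hd us}"
    and V: "pverts G = set us \<union> set p" and E: "uedges G = cycle_edges us \<union> set (path_edges p)"
    using assms unfolding B6_def by blast
  have ne: "us \<noteq> []" "p \<noteq> []" using us p by auto
  have cyc: "ucycle G us" using ucycle_if_edges[OF pg] us V E by auto
  obtain pos :: "'a \<Rightarrow> nat" where pos: "\<And>k. k < length p \<Longrightarrow> pos (p ! k) = k"
    by (rule ex_index[of "set p" p]) (use p in auto)
  define par where "par x = p ! (pos x - 1)" for x
  define dep where "dep x = (if x \<in> set p then pos x else 0)" for x
  have dep: "dep (p ! k) = k" if "k < length p" for k using that pos by (simp add: dep_def)
  have tree: "p ! Suc k \<in> pverts G - set us" if "Suc k < length p" for k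
  proof -
    have "p ! Suc k \<noteq> p ! 0" using nth_eq_iff_index_eq[OF p(2) that, of 0] ne by simp
    then have "p ! Suc k \<noteq> hd us" using p(3) ne by (simp add: hd_conv_nth)
    moreover have "p ! Suc k \<in> set p" using that by simp
    ultimately show ?thesis using p(4) V by blast
  qed
  have par: "par (p ! Suc k) = p ! k" if "Suc k < length p" for k using pos[OF that] by (simp add: par_def)
  have tree_index: "\<exists>k. Suc k < length p \<and> x = p ! Suc k" if "x \<in> pverts G - set us" for x
  proof -
    have "x \<in> set p" using that V by blast
    then obtain k where k: "k < length p" "x = p ! k" by (metis in_set_conv_nth)
    have "k \<noteq> 0"
    proof
      assume "k = 0"
      then have "x = hd us" using k p(3) ne by (simp add: hd_conv_nth)
      then show False using that ne by simp
    qed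
    then show ?thesis using k by (cases k) auto
  qed
  have tree_edges: "(\<lambda>x. {x, par x}) ` (pverts G - set us) = set (path_edges p)"
  proof -
    have "pverts G - set us = (\<lambda>k. p ! Suc k) ` {0..<length p - 1}"
    proof (intro equalityI subsetI)
      fix x assume "x \<in> pverts G - set us"
      then obtain k where "Suc k < length p" "x = p ! Suc k" using tree_index by blast
      then show "x \<in> (\<lambda>k. p ! Suc k) ` {0..<length p - 1}" by auto
    qed (use tree in auto)
    then have "(\<lambda>x. {x, par x}) ` (pverts G - set us) = (\<lambda>k. {p ! Suc k, par (p ! Suc k)}) ` {0..<length p - 1}"
      by (simp add: image_image)
    also have "\<dots> = (\<lambda>k. {p ! k, p ! Suc k}) ` {0..<length p - 1}"
      using par by (intro image_cong) auto
    finally show ?thesis by (simp add: path_edges_eq_map)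
  qed
  have uni: "unicyclic G us par dep"
  proof (intro unicyclic.intro rooted_cycle.intro unicyclic_axioms.intro)
    show "pair_graph G" "ucycle G us" using pg cyc .
    show "(x, par x) \<in> parcs G" if "x \<in> pverts G - set us" for x
    proof -
      have "{x, par x} \<in> uedges G" unfolding E tree_edges[symmetric] using that by (intro UnI2 imageI)
      then show ?thesis using uedge_iff[OF pg] by simp
    qed
    show "dep x = Suc (dep (par x))" if "x \<in> pverts G - set us" for x
      using tree_index[OF that] par dep by auto
    show "dep x = 0" if "x \<in> set us" for x
    proof (cases "x \<in> set p")
      case True
      then have "x = hd us" using that p(4) by blast
      then have "x = p ! 0" using p(3) ne by (simp add: hd_conv_nth)
      then show ?thesis using dep[of 0] ne by simp
    qed (simp add: dep_def)
    show "uedges G = cycle_edges us \<union> (\<lambda>x. {x, par x}) ` (pverts G - set us)" using E tree_edges by simp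
  qed
  interpret unicyclic G us par dep by (rule uni)
  have "root (p ! k) = us ! 0" if "k < length p" for k
    using that
  proof (induct k)
    case 0
    have "p ! 0 = us ! 0" using p(3) ne by (simp add: hd_conv_nth)
    then show ?case using us(1) by simp
  next
    case (Suc k)
    then show ?case using root_parent[OF tree[OF Suc.prems]] par[OF Suc.prems] by simp
  qed
  then have r: "root (p ! (length p - 1)) = us ! 0" using p(1) by simp
  have d: "dep (p ! (length p - 1)) = length p - 1" using dep p(1) by simp
  have "card (pverts G) = 6 + (length p - 1)"
  proof -
    have "card (set us) + card (set p) = card (set us \<union> set p) + card (set us \<inter> set p)"
      by (rule card_Un_Int) auto
    then show ?thesis using V p us by (simp add: distinct_card)
  qed
  then show ?thesis using that[OF uni us(1) _ r] d n p(1) V by simp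
qed

text \<open>The pair is the free end of the path and the cycle vertex opposite its root, which has
  depth 0.\<close>

lemma B6_distance:
  assumes "G \<in> B6 n"
  obtains u v where "u \<in> pverts G" "v \<in> pverts G" "u \<noteq> v"
    "\<And>p. vpath p G \<Longrightarrow> hd p = u \<Longrightarrow> last p = v \<Longrightarrow> n - 3 \<le> vwalk_length p"
proof -
  obtain us parent depth a where uni: "unicyclic G us parent depth" and l: "length us = 6"
    and a: "a \<in> pverts G" "rooted_cycle.root parent depth a = us ! 0" "n = 6 + depth a" "0 < depth a"
    using B6_structure[OF assms] by blast
  interpret unicyclic G us parent depth by (rule uni)
  have v: "us ! 3 \<in> set us" using l by simp
  have "a \<noteq> us ! 3" using a(4) depth_cycle[OF v] by auto
  moreover have "n - 3 \<le> vwalk_length p" if "vpath p G" "hd p = a" "last p = us ! 3" for p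
    using opposite_distance[OF l a(1), of "us ! 3" 0 p] that a(2,3) v cycle_facts(4) by auto
  ultimately show ?thesis using that[of a "us ! 3"] a(1) v cycle_facts(4) by blast
qed

text \<open>Any pair realizing the diameter works; n \<ge> 4 makes the diameter positive and the two
  vertices distinct.\<close>

lemma J1_distance:
  assumes "G \<in> J1 n" "4 \<le> n"
  obtains u v where "u \<in> pverts G" "v \<in> pverts G" "u \<noteq> v"
    "\<And>p. vpath p G \<Longrightarrow> hd p = u \<Longrightarrow> last p = v \<Longrightarrow> n - 3 \<le> vwalk_length p"
proof -
  have cu: "connected_unicyclic G" and n: "card (pverts G) = n" and d: "int (diam G) = int n - 3"
    using assms unfolding J1_def by auto
  interpret pair_graph G using cu by (simp add: connected_unicyclic_def)
  let ?S = "{gdist G u v | u v. u \<in> pverts G \<and> v \<in> pverts G}"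
  have "?S = (\<lambda>(u, v). gdist G u v) ` (pverts G \<times> pverts G)" by auto
  then have "finite ?S" by simp
  moreover have "pverts G \<noteq> {}" using n assms(2) by auto
  then have "?S \<noteq> {}" by blast
  ultimately have "diam G \<in> ?S" unfolding diam_def by (rule Max_in)
  then obtain u v where uv: "u \<in> pverts G" "v \<in> pverts G" "diam G = gdist G u v" by blast
  have "vpath [u] (with_proj G)" using uv by (auto simp: vpath_def vwalk_def)
  then have "gdist G u u = 0" using gdist_le[of "[u]" G] by simp
  then have "u \<noteq> v" using uv d assms(2) by auto
  moreover have "n - 3 \<le> vwalk_length p" if "vpath p (with_proj G)" "hd p = u" "last p = v" for p
    using gdist_le[OF that(1)] that uv(3) d by simp
  ultimately show ?thesis using that uv by blast
qed

theorem theorem3p3: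
  fixes G :: "'a pair_pre_digraph" and us :: "'a list" and n :: nat
  assumes "connected_unicyclic G"
    and "card (pverts G) = n"
    and "\<not> is_cycle_graph G"
    and "ucycle G us"
    and "length us \<ge> 6"
  shows "(G \<in> B6 n \<union> J1 n \<longrightarrow> int (trc G) = 2 * int n - 7) \<and>
         (G \<notin> B6 n \<union> J1 n \<longrightarrow> int (trc G) \<le> 2 * int n - 9)"
proof -
  obtain parent depth where uni: "unicyclic G us parent depth"
    using connected_unicyclic_structure[OF assms(1,4)] by blast
  interpret unicyclic G us parent depth by (rule uni)
  have "pverts G - set us \<noteq> {}"
  proof
    assume "pverts G - set us = {}"
    then have "pverts G = set us" "uedges G = cycle_edges us" using cycle_facts(4) edges by auto
    then show False using assms(3,4) unfolding is_cycle_graph_def by blast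
  qed
  then have ne: "leaves \<noteq> {}" using ex_leaf_above by blast
  have n: "6 \<le> n" using card_verts assms(2,5) by simp
  have trc_saves: "int (trc G) \<le> 2 * int n - int k" if sv: "saves k" for k
  proof -
    obtain c where "total_rainbow_connected G c" "num_colors G c + k \<le> 2 * n"
      using sv assms(2) unfolding saves_def by blast
    then show ?thesis using trc_le[of G c] by linarith
  qed
  have extremal: "int (trc G) = 2 * int n - 7" if G: "G \<in> B6 n \<union> J1 n"
  proof -
    \<comment> \<open>Both classes supply some 6-cycle; uniqueness of the cycle transfers its length
      to \<open>us\<close>.\<close>
    have "\<exists>vs. ucycle G vs \<and> length vs = 6"
      using G
    proof
      assume "G \<in> B6 n"
      then show ?thesis using B6_structure[of G n] by (metis rooted_cycle.cyc unicyclic.axioms(1))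
    next
      assume "G \<in> J1 n"
      then show ?thesis unfolding J1_def by blast
    qed
    then have "length us = 6" using unique_cycle_length[OF assms(1,4)] by metis
    then have s7: "saves 7" using saves_six ne by blast
    obtain u v where uv: "u \<in> pverts G" "v \<in> pverts G" "u \<noteq> v"
      "\<And>p. vpath p (with_proj G) \<Longrightarrow> hd p = u \<Longrightarrow> last p = v \<Longrightarrow> n - 3 \<le> vwalk_length p"
      using G
    proof
      assume "G \<in> B6 n"
      then show thesis by (rule B6_distance) (rule that)
    next
      assume "G \<in> J1 n"
      then show thesis by (rule J1_distance) (use n in simp, rule that)
    qed
    obtain c where "total_rainbow_connected G c" using s7 unfolding saves_def by blast
    then obtain c' where "total_rainbow_connected G c'" "num_colors G c' = trc G"
      by (rule trc_attained)
    then have "2 * (n - 3) \<le> trc G + 1" using num_colors_ge[OF graph _ uv] by metis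
    then show ?thesis using trc_saves[OF s7] n by linarith
  qed
  have other: "int (trc G) \<le> 2 * int n - 9" if G: "G \<notin> B6 n \<union> J1 n"
  proof -
    have "saves 9"
    proof (cases "length us = 6")
      case True
      show ?thesis
      proof (rule ccontr)
        assume "\<not> saves 9"
        with True ne show False
        proof (cases rule: six_cases)
          case (one a)
          then show False using single_leaf_in_B6[OF True] G assms(2) by blast
        next
          case (two a b i)
          then show False using opposite_leaves_in_J1[OF assms(1) True] G assms(2) by blast
        qed
      qed
    next
      case False
      then show ?thesis using saves_long_cycle[OF ne] assms(5) by simp
    qed
    then show ?thesis using trc_saves[of 9] by simp
  qed
  show ?thesis using extremal other by blast
qed

end
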